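(* Let $A$ be a square real matrix such that $A^2$ is normal. Then $A$ is orthogonally similar to a direct sum of real blocks, each of which has one of the following forms: $$\begin{bmatrix}\lambda\end{bmatrix}\ (\lambda\in\mathbb R),\qquad \tau\begin{bmatrix}0&1\\ \nu&0\end{bmatrix}\ (\nu,\tau\in\mathbb R,\ |\nu|<1,\ \tau>0),\qquad (1)$$ $$\begin{bmatrix}a&-b\\ b&a\end{bmatrix}\ (a,b\in\mathbb R,\ b>0),\qquad \tau\begin{bmatrix}0&0&1&0\\0&0&0&1\\ c&-d&0&0\\ d&c&0&0\end{bmatrix}\ (c,d,\tau\in\mathbb R,\ d>0,\ c^2+d^2<1,\ \tau>0).\qquad (2)$$ This direct sum is uniquely determined by $A$, up to permutation of summands. It can be obtained from the canonical form of $A$ under unitary similarity (the direct sum of complex blocks described in the context) by replacing all pairs of summands $$[a+bi]\oplus[a-bi]\ (b>0),\qquad \tau\begin{bmatrix}0&1\\ c+di&0\end{bmatrix}\oplus\tau\begin{bmatrix}0&1\\ c-di&0\end{bmatrix}\ (d>0)$$ by the corresponding matrices in (2) (the first kind of pair by the $2\times2$ matrix in (2) with the same $a,b$, the second kind of pair by the $4\times 4$ matrix in (2) with the same $c,d,\tau$). Conversely, if a square real matrix $A$ is unitarily similar to a direct sum of blocks of the forms (1) and (2), then $A^2$ is normal.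
   Context: A complex matrix $M$ is normal if $M^*M=MM^*$, where $M^*$ is the conjugate transpose. Two square complex matrices $A,B$ are unitarily similar if $B=S^{-1}AS$ for some unitary complex matrix $S$. Two square real matrices $A,B$ are orthogonally similar if $B=R^{-1}AR$ for some orthogonal real matrix $R$. The direct sum of square matrices is the block diagonal matrix with these matrices as diagonal blocks. Canonical form under unitary similarity (known result): every square complex matrix $A$ such that $A^2$ is normal is unitarily similar to a direct sum of blocks, each of which is $$\begin{bmatrix}\lambda\end{bmatrix}\quad\text{or}\quad \tau\begin{bmatrix}0&1\\ \nu&0\end{bmatrix},\qquad \lambda,\nu\in\mathbb C,\ |\nu|<1,\ \tau\in\mathbb R,\ \tau>0,$$ and this direct sum is uniquely determined by $A$ up to permutation of summands. This direct sum is what is meant by "the canonical form of $A$ under unitary similarity". *)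

theory Defs
  imports
    "HOL-Library.Multiset"
    "Jordan_Normal_Form.Schur_Decomposition"
begin

abbreviation complexify :: "real mat \<Rightarrow> complex mat" where
  "complexify \<equiv> map_mat complex_of_real"

definition normal_mat :: "complex mat \<Rightarrow> bool" where
  "normal_mat M \<longleftrightarrow> mat_adjoint M * M = M * mat_adjoint M"

definition unitary_mat :: "complex mat \<Rightarrow> bool" where
  "unitary_mat S \<longleftrightarrow> square_mat S \<and> mat_adjoint S * S = 1\<^sub>m (dim_row S)"

(* The library's orthogonal_mat only asks for nonzero, pairwise orthogonal columns;
   here the columns are orthonormal. *)
definition orthonormal_mat :: "real mat \<Rightarrow> bool" where
  "orthonormal_mat R \<longleftrightarrow> square_mat R \<and> transpose_mat R * R = 1\<^sub>m (dim_row R)"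

(* similar_mat_wit B A T S says that A, B, S, T are square of the same size,
   T is the two-sided inverse of S, and B = T * A * S. *)
definition unitarily_similar :: "complex mat \<Rightarrow> complex mat \<Rightarrow> bool" where
  "unitarily_similar A B \<longleftrightarrow> (\<exists>S T. unitary_mat S \<and> similar_mat_wit B A T S)"

definition orthogonally_similar :: "real mat \<Rightarrow> real mat \<Rightarrow> bool" where
  "orthogonally_similar A B \<longleftrightarrow> (\<exists>R T. orthonormal_mat R \<and> similar_mat_wit B A T R)"

definition block1 :: "'a \<Rightarrow> 'a mat" where
  "block1 l = mat_of_rows_list 1 [[l]]"

definition block2 :: "'a::ring_1 \<Rightarrow> 'a \<Rightarrow> 'a mat" where
  "block2 t \<nu> = t \<cdot>\<^sub>m mat_of_rows_list 2 [[0, 1], [\<nu>, 0]]"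

definition rot_block :: "real \<Rightarrow> real \<Rightarrow> real mat" where
  "rot_block a b = mat_of_rows_list 2 [[a, -b], [b, a]]"

definition block4 :: "real \<Rightarrow> real \<Rightarrow> real \<Rightarrow> real mat" where
  "block4 t c d = t \<cdot>\<^sub>m mat_of_rows_list 4
     [[0, 0, 1, 0],
      [0, 0, 0, 1],
      [c, -d, 0, 0],
      [d, c, 0, 0]]"

definition complex_blocks :: "complex mat set" where
  "complex_blocks =
     {block1 l | l. True} \<union>
     {block2 (complex_of_real t) \<nu> | t \<nu>. t > 0 \<and> cmod \<nu> < 1}"

definition real_blocks :: "real mat set" where
  "real_blocks =
     {block1 l | l. True} \<union>
     {block2 t \<nu> | t \<nu>. t > 0 \<and> \<bar>\<nu>\<bar> < 1} \<union>
     {rot_block a b | a b. b > 0} \<union>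
     {block4 t c d | t c d. t > 0 \<and> d > 0 \<and> c\<^sup>2 + d\<^sup>2 < 1}"

definition complex_canonical_form :: "complex mat \<Rightarrow> complex mat list \<Rightarrow> bool" where
  "complex_canonical_form A Cs \<longleftrightarrow>
     set Cs \<subseteq> complex_blocks \<and> unitarily_similar A (diag_block_mat Cs)"

definition real_canonical_form :: "real mat \<Rightarrow> real mat list \<Rightarrow> bool" where
  "real_canonical_form A Bs \<longleftrightarrow>
     set Bs \<subseteq> real_blocks \<and> orthogonally_similar A (diag_block_mat Bs)"

(* Direct sums up to permutation of summands are multisets of blocks.
   One step replaces one pair of summands by the corresponding real block. *)
inductive replace_pair :: "complex mat multiset \<Rightarrow> complex mat multiset \<Rightarrow> bool" where
  "b > 0 \<Longrightarrow>
     replace_pair (M + {#block1 (Complex a b), block1 (Complex a (-b))#})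
                  (M + {#complexify (rot_block a b)#})"
| "t > 0 \<Longrightarrow> d > 0 \<Longrightarrow> c\<^sup>2 + d\<^sup>2 < 1 \<Longrightarrow>
     replace_pair (M + {#block2 (complex_of_real t) (Complex c d),
                         block2 (complex_of_real t) (Complex c (-d))#})
                  (M + {#complexify (block4 t c d)#})"

definition replace_all_pairs :: "complex mat multiset \<Rightarrow> complex mat multiset \<Rightarrow> bool" where
  "replace_all_pairs M N \<longleftrightarrow> replace_pair\<^sup>*\<^sup>* M N \<and> \<not> (\<exists>N'. replace_pair N N')"

end

theory Submission
  imports Defs
begin

text \<open>
  Let \<open>A\<close> be a matrix whose square is normal. By Fuglede's theorem the adjoint of \<open>A\<close> commutes with
  \<open>A\<^sup>2\<close> (\<open>Ad_A_A\<close>, \<open>Ad_Ad_A\<close>). Hence \<open>A\<^sup>2\<close>, \<open>A\<^sup>* A\<close> and \<open>A A\<^sup>*\<close> commute and have common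
  eigenvectors over the complex numbers. Let \<open>x, s, r\<close> be the eigenvalues. Both \<open>A\<close> and its adjoint
  exchange the roles of \<open>s\<close> and \<open>r\<close>.
  
  Existence (\<open>real_canonical_form_exists\<close>). If \<open>s = r\<close>, then \<open>A\<close> acts normally on the joint
  eigenspace and has an eigenvector there, which is also one of the adjoint. Otherwise \<open>s > r\<close> can be
  arranged, and a unit joint eigenvector \<open>f\<close> together with \<open>A f / \<surd>s\<close> is an orthonormal basis of a
  plane on which \<open>A\<close> is the block \<open>t [[0, 1], [\<nu>, 0]]\<close> with \<open>t = \<surd>s\<close> and \<open>\<nu> = x / s\<close>
  (\<open>joint_eigenvector_pair\<close>). When \<open>A\<close> is real and the eigenvalue, respectively \<open>x\<close>, is real, the
  vectors can be taken real. When it is not, the vectors are orthogonal to all their complex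
  conjugates, so their real and negative imaginary parts are, after scaling, an orthonormal system on
  which \<open>A\<close> is a real block of twice the size. In each case the span reduces \<open>A\<close>, and
  induction applies to the orthogonal complement.
  
  Uniqueness (\<open>real_canonical_form_unique\<close>). The characteristic polynomials of the pencil
  \<open>A + s (A\<^sup>* A + A A\<^sup>*)\<close> are invariant under unitary similarity. A complex block contributes the
  roots \<open>m + s k\<close> with \<open>(m, k) = (l, 2 \<bar>l\<bar>\<^sup>2)\<close>, or with \<open>m\<^sup>2 = t\<^sup>2 \<nu>\<close> and
  \<open>k = t\<^sup>2 (1 + \<bar>\<nu>\<bar>\<^sup>2)\<close>. For a slope \<open>s\<close> that separates the finitely many pairs involved, the roots give
  back the pairs, and a pair determines its block
  (\<open>leading_joint_eigenvalue_determines_block\<close>). So direct sums of complex blocks are determined by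
  the pencil. A real block is unitarily similar either to itself as a complex block or to the pair of
  complex blocks that it replaces (\<open>complexify_unitarily_similar_split\<close>). This carries uniqueness
  over to real blocks, identifies every complex canonical form of \<open>A\<close> with the split real one, and
  yields the converse, because the squares of complex blocks are scalar.
\<close>

lemmas square_mat_simps =
  assoc_mult_mat[of _ n n _ n _ n] left_mult_one_mat[of _ n n] right_mult_one_mat[of _ n n]
  mult_carrier_mat[of _ n n _ n] for n

section \<open>Adjoints, complexification and diagonal blocks\<close>

lemma dim_mat_adjoint [simp]:
  "dim_row (mat_adjoint M) = dim_col M" "dim_col (mat_adjoint M) = dim_row M"
  by (simp_all add: mat_adjoint_def)

lemma mat_adjoint_carrier [simp]: "mat_adjoint M \<in> carrier_mat m n \<longleftrightarrow> M \<in> carrier_mat n m"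
  by (metis carrier_matD carrier_matI dim_mat_adjoint)

lemma index_mat_adjoint [simp]:
  "i < dim_col M \<Longrightarrow> j < dim_row M \<Longrightarrow> mat_adjoint M $$ (i, j) = conjugate (M $$ (j, i))"
  by (simp add: mat_adjoint_def mat_of_rows_def)

lemma adjoint_adjoint [simp]: "mat_adjoint (mat_adjoint M) = M"
  by (rule eq_matI) auto

lemma adjoint_one [simp]: "mat_adjoint (1\<^sub>m n) = (1\<^sub>m n :: complex mat)"
  by (rule eq_matI) auto

lemma adjoint_mult:
  fixes M N :: "complex mat"
  assumes "M \<in> carrier_mat n m" "N \<in> carrier_mat m l"
  shows "mat_adjoint (M * N) = mat_adjoint N * mat_adjoint M"
  using assms by (intro eq_matI) (auto simp: scalar_prod_def mult.commute)

lemma adjoint_minus: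
  fixes M N :: "complex mat"
  assumes "M \<in> carrier_mat n m" "N \<in> carrier_mat n m"
  shows "mat_adjoint (M - N) = mat_adjoint M - mat_adjoint N"
  using assms by (intro eq_matI) auto

lemma adjoint_four_block:
  fixes M N :: "complex mat"
  assumes "M \<in> carrier_mat n n" "N \<in> carrier_mat m m"
  shows "mat_adjoint (four_block_mat M (0\<^sub>m n m) (0\<^sub>m m n) N) =
    four_block_mat (mat_adjoint M) (0\<^sub>m n m) (0\<^sub>m m n) (mat_adjoint N)"
  using assms by (intro eq_matI) auto

lemma adjoint_complexify [simp]:
  "mat_adjoint (complexify R) = complexify (transpose_mat R)"
  by (rule eq_matI) auto

lemma complexify_mult:
  "R \<in> carrier_mat n m \<Longrightarrow> Q \<in> carrier_mat m l \<Longrightarrow> complexify (R * Q) = complexify R * complexify Q"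
  by (rule of_real_hom.mat_hom_mult)

lemma complexify_one [simp]: "complexify (1\<^sub>m n) = 1\<^sub>m n"
  by (rule eq_matI) auto

lemma mult_diag_four_block:
  fixes M N M' N' :: "'a :: semiring_1 mat"
  assumes "M \<in> carrier_mat n n" "N \<in> carrier_mat m m" "M' \<in> carrier_mat n n" "N' \<in> carrier_mat m m"
  shows "four_block_mat M (0\<^sub>m n m) (0\<^sub>m m n) N * four_block_mat M' (0\<^sub>m n m) (0\<^sub>m m n) N' =
    four_block_mat (M * M') (0\<^sub>m n m) (0\<^sub>m m n) (N * N')"
  using assms by (subst mult_four_block_mat[of _ n n _ m _ m _ _ n _ m]) auto

lemma diag_four_block_eq_iff:
  assumes "M \<in> carrier_mat n n" "N \<in> carrier_mat m m" "M' \<in> carrier_mat n n" "N' \<in> carrier_mat m m"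
  shows "four_block_mat M (0\<^sub>m n m) (0\<^sub>m m n) N = four_block_mat M' (0\<^sub>m n m) (0\<^sub>m m n) N' \<longleftrightarrow>
    M = M' \<and> N = N'" (is "?L = ?R \<longleftrightarrow> _")
proof
  assume eq: "?L = ?R"
  have "M $$ (i, j) = M' $$ (i, j)" if "i < n" "j < n" for i j
    using arg_cong[OF eq, of "\<lambda>Z. Z $$ (i, j)"] that assms by auto
  moreover have "N $$ (i, j) = N' $$ (i, j)" if "i < m" "j < m" for i j
    using arg_cong[OF eq, of "\<lambda>Z. Z $$ (n + i, n + j)"] that assms by auto
  ultimately show "M = M' \<and> N = N'" using assms by (auto intro!: eq_matI)
qed auto

text \<open>
  The library unfolds \<^const>\<open>diag_block_mat\<close> with zero blocks sized by the dimensions of the summands;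
  naming the two sizes makes the identities for two diagonal blocks applicable as rewrite rules.
\<close>

lemma diag_block_mat_Cons_square:
  assumes "M \<in> carrier_mat n n" "diag_block_mat Ms \<in> carrier_mat m m"
  shows "diag_block_mat (M # Ms) = four_block_mat M (0\<^sub>m n m) (0\<^sub>m m n) (diag_block_mat Ms)"
  using assms by (auto simp: Let_def)

lemma diag_block_mat_carrier:
  assumes "\<forall>M \<in> set Ms. square_mat M"
  shows "diag_block_mat Ms \<in> carrier_mat (sum_list (map dim_row Ms)) (sum_list (map dim_row Ms))"
  using diag_block_mat_square[of Ms] assms dim_diag_block_mat[of Ms]
  by (metis carrier_matI square_mat.elims(2))

lemma complexify_diag_block_mat:
  "complexify (diag_block_mat Ms) = diag_block_mat (map complexify Ms)"
proof (induction Ms)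
  case (Cons M Ms)
  have *: "dim_row (diag_block_mat (map complexify Ms)) = dim_row (diag_block_mat Ms)"
    "dim_col (diag_block_mat (map complexify Ms)) = dim_col (diag_block_mat Ms)"
    by (simp_all flip: Cons)
  have z: "complexify (0\<^sub>m a b) = 0\<^sub>m a b" for a b by (rule eq_matI) auto
  show ?case
    unfolding diag_block_mat.simps list.map Let_def
    by (subst map_four_block_mat[of _ "dim_row M" "dim_col M" _ "dim_col (diag_block_mat Ms)" _ "dim_row (diag_block_mat Ms)"])
       (auto simp: * z Cons)
qed auto

lemma pow_mat_two: "M \<in> carrier_mat n n \<Longrightarrow> M ^\<^sub>m 2 = M * (M :: 'a :: semiring_1 mat)"
  by (simp add: numeral_2_eq_2)

section \<open>Unitary and orthogonal similarity\<close>

lemma unitarily_similarE: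
  assumes "unitarily_similar M N" "M \<in> carrier_mat n n"
  obtains S where "S \<in> carrier_mat n n" "mat_adjoint S * S = 1\<^sub>m n" "S * mat_adjoint S = 1\<^sub>m n"
    "N = mat_adjoint S * M * S" "N \<in> carrier_mat n n"
proof -
  obtain S T where S: "unitary_mat S" and wit: "similar_mat_wit N M T S"
    using assms unfolding unitarily_similar_def by auto
  have N: "N \<in> carrier_mat n n"
    using similar_mat_witD[OF refl wit] assms(2) by (metis carrier_matD(1))
  note w = similar_mat_witD2[OF N wit]
  have adj: "mat_adjoint S \<in> carrier_mat n n" using w by simp
  have 1: "mat_adjoint S * S = 1\<^sub>m n" using S w unfolding unitary_mat_def by auto
  have 2: "S * mat_adjoint S = 1\<^sub>m n" using mat_mult_left_right_inverse[OF adj w(7) 1] .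
  have "T = T * (S * mat_adjoint S)" using 2 w(6) by simp
  also have "\<dots> = (T * S) * mat_adjoint S" using w(6,7) adj by (simp add: square_mat_simps[where n = n])
  also have "\<dots> = mat_adjoint S" using w(1) adj by (simp add: square_mat_simps[where n = n])
  finally have "T = mat_adjoint S" .
  then show thesis using that[OF w(7) 1 2] w by auto
qed

lemma unitarily_similarI:
  assumes "M \<in> carrier_mat n n" "S \<in> carrier_mat n n" "mat_adjoint S * S = 1\<^sub>m n"
    "N = mat_adjoint S * M * S"
  shows "unitarily_similar M N"
proof -
  have adj: "mat_adjoint S \<in> carrier_mat n n" using assms by simp
  have "S * mat_adjoint S = 1\<^sub>m n" using mat_mult_left_right_inverse[OF adj assms(2,3)] .
  then have "similar_mat_wit N M (mat_adjoint S) S"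
    using assms adj by (intro similar_mat_witI[of _ _ n]) (simp_all add: square_mat_simps[where n = n])
  then show ?thesis unfolding unitarily_similar_def unitary_mat_def using assms by auto
qed

lemma orthogonally_similarE:
  assumes "orthogonally_similar M N" "M \<in> carrier_mat n n"
  obtains R where "R \<in> carrier_mat n n" "transpose_mat R * R = 1\<^sub>m n" "R * transpose_mat R = 1\<^sub>m n"
    "N = transpose_mat R * M * R" "N \<in> carrier_mat n n"
proof -
  obtain R T where R: "orthonormal_mat R" and wit: "similar_mat_wit N M T R"
    using assms unfolding orthogonally_similar_def by auto
  have N: "N \<in> carrier_mat n n"
    using similar_mat_witD[OF refl wit] assms(2) by (metis carrier_matD(1))
  note w = similar_mat_witD2[OF N wit]
  have adj: "transpose_mat R \<in> carrier_mat n n" using w by simp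
  have 1: "transpose_mat R * R = 1\<^sub>m n" using R w unfolding orthonormal_mat_def by auto
  have 2: "R * transpose_mat R = 1\<^sub>m n" using mat_mult_left_right_inverse[OF adj w(7) 1] .
  have "T = T * (R * transpose_mat R)" using 2 w(6) by simp
  also have "\<dots> = (T * R) * transpose_mat R" using w(6,7) adj by (simp add: square_mat_simps[where n = n])
  also have "\<dots> = transpose_mat R" using w(1) adj by (simp add: square_mat_simps[where n = n])
  finally have "T = transpose_mat R" .
  then show thesis using that[OF w(7) 1 2] w by auto
qed

lemma orthogonally_similarI:
  assumes "M \<in> carrier_mat n n" "R \<in> carrier_mat n n" "transpose_mat R * R = 1\<^sub>m n"
    "N = transpose_mat R * M * R"
  shows "orthogonally_similar M N"
proof -
  have adj: "transpose_mat R \<in> carrier_mat n n" using assms by simp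
  have "R * transpose_mat R = 1\<^sub>m n" using mat_mult_left_right_inverse[OF adj assms(2,3)] .
  then have "similar_mat_wit N M (transpose_mat R) R"
    using assms adj by (intro similar_mat_witI[of _ _ n]) (simp_all add: square_mat_simps[where n = n])
  then show ?thesis unfolding orthogonally_similar_def orthonormal_mat_def using assms by auto
qed

lemma orthogonally_similar_imp_unitarily_similar:
  assumes "orthogonally_similar M N" "M \<in> carrier_mat n n"
  shows "unitarily_similar (complexify M) (complexify N)"
proof -
  obtain R where R: "R \<in> carrier_mat n n" "transpose_mat R * R = 1\<^sub>m n" "N = transpose_mat R * M * R"
    using orthogonally_similarE[OF assms] by metis
  have "complexify (transpose_mat R) * complexify R = 1\<^sub>m n"
    using R(2) complexify_mult[of "transpose_mat R" n n R n] R(1) by simp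
  moreover have "complexify N = complexify (transpose_mat R) * complexify M * complexify R"
    unfolding R(3) using R(1) assms(2) by (simp add: complexify_mult[of _ n n _ n])
  ultimately show ?thesis
    by (intro unitarily_similarI[of _ n "complexify R"]) (use R assms in auto)
qed

lemma orthogonally_similar_trans:
  assumes "orthogonally_similar L M" "orthogonally_similar M N" "L \<in> carrier_mat n n"
  shows "orthogonally_similar L N"
proof -
  obtain R where R: "R \<in> carrier_mat n n" "transpose_mat R * R = 1\<^sub>m n" "M = transpose_mat R * L * R"
    and M: "M \<in> carrier_mat n n"
    using orthogonally_similarE[OF assms(1,3)] by metis
  obtain Q where Q: "Q \<in> carrier_mat n n" "transpose_mat Q * Q = 1\<^sub>m n" "N = transpose_mat Q * M * Q"
    using orthogonally_similarE[OF assms(2) M] by metis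
  note [simp] = square_mat_simps[where n = n]
  have t: "transpose_mat (R * Q) = transpose_mat Q * transpose_mat R"
    using R Q by (intro transpose_mult)
  have "transpose_mat Q * (transpose_mat R * R) * Q = 1\<^sub>m n"
    unfolding R(2) using Q by simp
  then have "transpose_mat (R * Q) * (R * Q) = 1\<^sub>m n" using R(1) Q(1) by (simp add: t)
  moreover have "N = transpose_mat (R * Q) * L * (R * Q)"
    using Q(1) R(1) assms(3) unfolding Q(3) R(3) t by simp
  ultimately show ?thesis
    by (intro orthogonally_similarI[of _ n "R * Q"]) (use R Q assms in auto)
qed

lemma orthogonally_similar_four_block:
  assumes "orthogonally_similar M N" "M \<in> carrier_mat m m" "B \<in> carrier_mat k k"
  shows "orthogonally_similar (four_block_mat B (0\<^sub>m k m) (0\<^sub>m m k) M)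
    (four_block_mat B (0\<^sub>m k m) (0\<^sub>m m k) N)"
proof -
  obtain R where R: "R \<in> carrier_mat m m" "transpose_mat R * R = 1\<^sub>m m" "N = transpose_mat R * M * R"
    using orthogonally_similarE[OF assms(1,2)] by metis
  let ?R = "four_block_mat (1\<^sub>m k) (0\<^sub>m k m) (0\<^sub>m m k) R"
  have t: "transpose_mat ?R = four_block_mat (1\<^sub>m k) (0\<^sub>m k m) (0\<^sub>m m k) (transpose_mat R)"
    using R(1) by (subst transpose_four_block_mat[of _ k k _ m _ m]) auto
  show ?thesis
    by (rule orthogonally_similarI[of _ "k + m" ?R], unfold t)
       (use R assms in \<open>auto simp: mult_diag_four_block[of _ k _ m] R(2) simp flip: R(3)\<close>)
qed

text \<open>
  Conjugation by a unitary matrix is an injective map that respects products and adjoints,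
  so it preserves every identity between words in a matrix and its adjoint.
\<close>

lemma normal_square_unitarily_similar:
  assumes "unitarily_similar M N" "M \<in> carrier_mat n n"
  shows "normal_mat (M ^\<^sub>m 2) \<longleftrightarrow> normal_mat (N ^\<^sub>m 2)"
proof -
  obtain S where S: "S \<in> carrier_mat n n" "mat_adjoint S * S = 1\<^sub>m n" "S * mat_adjoint S = 1\<^sub>m n"
    "N = mat_adjoint S * M * S" "N \<in> carrier_mat n n"
    using unitarily_similarE[OF assms] by metis
  let ?S = "mat_adjoint S"
  have conj: "(?S * X * S) * (?S * Y * S) = ?S * (X * Y) * S"
    if "X \<in> carrier_mat n n" "Y \<in> carrier_mat n n" for X Y
  proof -
    have "(?S * X * S) * (?S * Y * S) = ?S * X * (S * ?S) * Y * S"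
      using S(1) that by (simp add: square_mat_simps[where n = n])
    then show ?thesis unfolding S(3) using S(1) that by (simp add: square_mat_simps[where n = n])
  qed
  have inj: "?S * X * S = ?S * Y * S \<longleftrightarrow> X = Y"
    if "X \<in> carrier_mat n n" "Y \<in> carrier_mat n n" for X Y
  proof -
    have "S * (?S * X * S) * ?S = X" if "X \<in> carrier_mat n n" for X
    proof -
      have "S * (?S * X * S) * ?S = (S * ?S) * X * (S * ?S)"
        using S(1) that by (simp add: square_mat_simps[where n = n])
      then show ?thesis unfolding S(3) using that by simp
    qed
    then show ?thesis using that by metis
  qed
  have adj: "mat_adjoint (?S * X * S) = ?S * mat_adjoint X * S" if "X \<in> carrier_mat n n" for X
    using S(1) that
    by (simp add: adjoint_mult[of _ n n _ n] square_mat_simps[where n = n])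
  have M2: "M * M \<in> carrier_mat n n" using assms by simp
  have N2: "N ^\<^sub>m 2 = ?S * (M * M) * S"
    using conj[OF assms(2) assms(2)] unfolding pow_mat_two[OF S(5)] by (simp only: S(4))
  have "normal_mat (N ^\<^sub>m 2) \<longleftrightarrow> normal_mat (M * M)"
    unfolding N2 normal_mat_def adj[OF M2] using M2 by (simp add: conj inj square_mat_simps(4)[where n = n])
  then show ?thesis using pow_mat_two[OF assms(2)] by simp
qed

lemma normal_square_four_block:
  assumes "M \<in> carrier_mat n n" "N \<in> carrier_mat m m"
  shows "normal_mat (four_block_mat M (0\<^sub>m n m) (0\<^sub>m m n) N ^\<^sub>m 2) \<longleftrightarrow>
    normal_mat (M ^\<^sub>m 2) \<and> normal_mat (N ^\<^sub>m 2)"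
proof -
  have [simp]: "M ^\<^sub>m 2 = M * M" "N ^\<^sub>m 2 = N * N"
    "four_block_mat M (0\<^sub>m n m) (0\<^sub>m m n) N ^\<^sub>m 2 =
      four_block_mat M (0\<^sub>m n m) (0\<^sub>m m n) N * four_block_mat M (0\<^sub>m n m) (0\<^sub>m m n) N"
    using assms pow_mat_two[OF four_block_carrier_mat[OF assms]] by (auto simp: pow_mat_two)
  show ?thesis
    unfolding normal_mat_def using assms
    by (simp add: adjoint_four_block[of _ n _ m] mult_diag_four_block[of _ n _ m]
      diag_four_block_eq_iff[of _ n _ m] mult_carrier_mat[of _ n n _ n] mult_carrier_mat[of _ m m _ m])
qed

section \<open>The anticommutator pencil\<close>

text \<open>
  The invariant behind uniqueness. If the square of \<open>M\<close> is normal, the Hermitian matrix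
  \<open>M\<^sup>* M + M M\<^sup>*\<close> commutes with \<open>M\<close>, and on each canonical block it is a scalar. The
  characteristic polynomials of this pencil for varying \<open>s\<close> therefore record the joint
  eigenvalues of the two matrices.
\<close>

definition anticommutator_pencil :: "complex \<Rightarrow> complex mat \<Rightarrow> complex mat" where
  "anticommutator_pencil s M = M + s \<cdot>\<^sub>m (mat_adjoint M * M + M * mat_adjoint M)"

lemma anticommutator_pencil_carrier [simp]:
  "M \<in> carrier_mat n n \<Longrightarrow> anticommutator_pencil s M \<in> carrier_mat n n"
  unfolding anticommutator_pencil_def by auto

lemma char_poly_pencil_unitarily_similar:
  assumes "unitarily_similar M N" "M \<in> carrier_mat n n"
  shows "char_poly (anticommutator_pencil s M) = char_poly (anticommutator_pencil s N)"
proof -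
  obtain S where S: "S \<in> carrier_mat n n" "mat_adjoint S * S = 1\<^sub>m n" "S * mat_adjoint S = 1\<^sub>m n"
    "N = mat_adjoint S * M * S" "N \<in> carrier_mat n n"
    using unitarily_similarE[OF assms] by metis
  let ?S = "mat_adjoint S"
  have conj: "?S * (X * Y) * S = (?S * X * S) * (?S * Y * S)"
    if "X \<in> carrier_mat n n" "Y \<in> carrier_mat n n" for X Y
  proof -
    have "(?S * X * S) * (?S * Y * S) = ?S * X * (S * ?S) * Y * S"
      using S(1) that by (simp add: square_mat_simps[where n = n])
    then show ?thesis unfolding S(3) using S(1) that by (simp add: square_mat_simps[where n = n])
  qed
  have adj: "mat_adjoint N = ?S * mat_adjoint M * S"
    unfolding S(4) using S(1) assms(2) by (simp add: adjoint_mult[of _ n n _ n] square_mat_simps[where n = n])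
  have M: "mat_adjoint M \<in> carrier_mat n n" using assms by simp
  let ?K = "mat_adjoint M * M + M * mat_adjoint M"
  have K: "mat_adjoint N * N + N * mat_adjoint N = ?S * ?K * S"
  proof -
    have "?S * ?K * S = ?S * (mat_adjoint M * M) * S + ?S * (M * mat_adjoint M) * S"
      using S(1) assms(2) M
      by (simp add: mult_add_distrib_mat[of _ n n _ n] add_mult_distrib_mat[of _ n n _ _ n] square_mat_simps(4)[where n = n])
    then show ?thesis
      using conj[OF M assms(2)] conj[OF assms(2) M] adj S(4) by simp
  qed
  have "anticommutator_pencil s N = ?S * anticommutator_pencil s M * S"
  proof -
    have Kc: "?K \<in> carrier_mat n n" using assms(2) M by auto
    have "?S * (M + s \<cdot>\<^sub>m ?K) * S = ?S * M * S + s \<cdot>\<^sub>m (?S * ?K * S)"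
      using S(1) assms(2) Kc
      by (simp add: mult_add_distrib_mat[of _ n n _ n] add_mult_distrib_mat[of _ n n _ _ n]
        mult_smult_distrib[of _ n n _ n] mult_smult_assoc_mat[of _ n n _ n] square_mat_simps(4)[where n = n]
        del: assoc_mult_mat)
    then show ?thesis
      unfolding anticommutator_pencil_def K using S(4) by simp
  qed
  then have "similar_mat_wit (anticommutator_pencil s N) (anticommutator_pencil s M) ?S S"
    using S assms by (intro similar_mat_witI[of _ _ n]) auto
  then have "similar_mat (anticommutator_pencil s N) (anticommutator_pencil s M)"
    unfolding similar_mat_def by blast
  then show ?thesis using char_poly_similar by metis
qed

lemma pencil_four_block:
  assumes "M \<in> carrier_mat n n" "N \<in> carrier_mat m m"
  shows "anticommutator_pencil s (four_block_mat M (0\<^sub>m n m) (0\<^sub>m m n) N) =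
    four_block_mat (anticommutator_pencil s M) (0\<^sub>m n m) (0\<^sub>m m n) (anticommutator_pencil s N)"
proof -
  have c: "mat_adjoint M * M \<in> carrier_mat n n" "M * mat_adjoint M \<in> carrier_mat n n"
    "mat_adjoint N * N \<in> carrier_mat m m" "N * mat_adjoint N \<in> carrier_mat m m"
    using assms by auto
  have a: "mat_adjoint M \<in> carrier_mat n n" "mat_adjoint N \<in> carrier_mat m m" using assms by auto
  show ?thesis
    unfolding anticommutator_pencil_def adjoint_four_block[OF assms]
      mult_diag_four_block[OF a assms] mult_diag_four_block[OF assms a]
    using assms c by (intro eq_matI) auto
qed

lemma char_poly_diag_four_block:
  fixes M N :: "complex mat"
  assumes "M \<in> carrier_mat n n" "N \<in> carrier_mat m m"
  shows "char_poly (four_block_mat M (0\<^sub>m n m) (0\<^sub>m m n) N) = char_poly M * char_poly N"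
  using char_poly_0_block'[OF refl _ _ assms(1) zero_carrier_mat assms(2)]
    char_poly_factorized[OF assms(1)] char_poly_factorized[OF assms(2)] by blast

lemma char_poly_pencil_diag_block_mat:
  assumes "\<forall>M \<in> set Ms. square_mat M"
  shows "char_poly (anticommutator_pencil s (diag_block_mat Ms)) =
    (\<Prod>M\<leftarrow>Ms. char_poly (anticommutator_pencil s M))"
  using assms
proof (induction Ms)
  case Nil
  have "anticommutator_pencil s (0\<^sub>m 0 0) \<in> carrier_mat 0 0" by simp
  then show ?case unfolding char_poly_def by simp
next
  case (Cons M Ms)
  let ?m = "sum_list (map dim_row Ms)"
  have M: "M \<in> carrier_mat (dim_row M) (dim_row M)" using Cons.prems by auto
  have Ms: "diag_block_mat Ms \<in> carrier_mat ?m ?m"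
    using Cons.prems by (intro diag_block_mat_carrier) auto
  show ?case
    unfolding diag_block_mat_Cons_square[OF M Ms] pencil_four_block[OF M Ms]
      char_poly_diag_four_block[OF anticommutator_pencil_carrier[OF M] anticommutator_pencil_carrier[OF Ms]]
    using Cons.IH Cons.prems by simp
qed

section \<open>The blocks and their joint spectra\<close>

lemma block1_carrier [simp]: "block1 l \<in> carrier_mat 1 1"
  by (rule carrier_matI) (simp_all add: block1_def mat_of_rows_list_def)

lemma block2_carrier [simp]: "block2 t \<nu> \<in> carrier_mat 2 2"
  by (rule carrier_matI) (simp_all add: block2_def mat_of_rows_list_def)

lemma rot_block_carrier [simp]: "rot_block a b \<in> carrier_mat 2 2"
  by (rule carrier_matI) (simp_all add: rot_block_def mat_of_rows_list_def)

lemma block4_carrier [simp]: "block4 t c d \<in> carrier_mat 4 4"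
  by (rule carrier_matI) (simp_all add: block4_def mat_of_rows_list_def)

lemma dim_blocks [simp]:
  "dim_row (block1 l) = 1" "dim_col (block1 l) = 1"
  "dim_row (block2 t \<nu>) = 2" "dim_col (block2 t \<nu>) = 2"
  "dim_row (rot_block a b) = 2" "dim_col (rot_block a b) = 2"
  "dim_row (block4 \<tau> c d) = 4" "dim_col (block4 \<tau> c d) = 4"
  by (simp_all add: block1_def block2_def rot_block_def block4_def mat_of_rows_list_def)

lemma index_block1 [simp]: "block1 l $$ (0, 0) = l"
  by (simp add: block1_def mat_of_rows_list_def)

lemma index_block2 [simp]:
  "block2 t \<nu> $$ (0, 0) = 0" "block2 t \<nu> $$ (0, 1) = t" "block2 t \<nu> $$ (0, Suc 0) = t"
  "block2 t \<nu> $$ (1, 0) = t * \<nu>" "block2 t \<nu> $$ (Suc 0, 0) = t * \<nu>"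
  "block2 t \<nu> $$ (1, 1) = 0" "block2 t \<nu> $$ (Suc 0, Suc 0) = 0"
  by (simp_all add: block2_def mat_of_rows_list_def)

lemma index_rot_block [simp]:
  "rot_block a b $$ (0, 0) = a" "rot_block a b $$ (0, 1) = - b" "rot_block a b $$ (0, Suc 0) = - b"
  "rot_block a b $$ (1, 0) = b" "rot_block a b $$ (Suc 0, 0) = b"
  "rot_block a b $$ (1, 1) = a" "rot_block a b $$ (Suc 0, Suc 0) = a"
  by (simp_all add: rot_block_def mat_of_rows_list_def)

lemma index_block4:
  "i < 4 \<Longrightarrow> j < 4 \<Longrightarrow> block4 t c d $$ (i, j) =
    t * ([[0, 0, 1, 0], [0, 0, 0, 1], [c, -d, 0, 0], [d, c, 0, 0]] ! i ! j)"
  by (simp add: block4_def mat_of_rows_list_def)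

lemma block1_eq_iff [simp]: "block1 l = block1 l' \<longleftrightarrow> l = l'"
  using index_block1 by metis

lemma block1_neq_block2 [simp]: "block1 l \<noteq> block2 t \<nu>" "block2 t \<nu> \<noteq> block1 l"
  by (auto dest!: arg_cong[of _ _ dim_row])

lemma block2_eq_iff:
  "block2 t \<nu> = block2 t' \<nu>' \<longleftrightarrow> t = t' \<and> t * \<nu> = t' * \<nu>'"
proof
  assume "block2 t \<nu> = block2 t' \<nu>'"
  then have "block2 t \<nu> $$ (0, 1) = block2 t' \<nu>' $$ (0, 1)" "block2 t \<nu> $$ (1, 0) = block2 t' \<nu>' $$ (1, 0)"
    by simp_all
  then show "t = t' \<and> t * \<nu> = t' * \<nu>'" by simp
next
  assume "t = t' \<and> t * \<nu> = t' * \<nu>'"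
  then show "block2 t \<nu> = block2 t' \<nu>'"
    by (intro eq_matI) (auto simp: less_2_cases_iff)
qed

lemma complexify_block1: "complexify (block1 l) = block1 (complex_of_real l)"
  by (rule eq_matI) auto

lemma complexify_block2: "complexify (block2 t \<nu>) = block2 (complex_of_real t) (complex_of_real \<nu>)"
  by (rule eq_matI) (auto simp: less_2_cases_iff)

text \<open>
  The joint eigenvalues \<open>(m, k)\<close> of a complex block and its anticommutator with its adjoint:
  \<open>(l, 2 \<bar>l\<bar>\<^sup>2)\<close> for \<open>[l]\<close>, and \<open>(\<plusminus>\<mu>, t\<^sup>2 (1 + \<bar>\<nu>\<bar>\<^sup>2))\<close> with \<open>\<mu>\<^sup>2 = t\<^sup>2 \<nu>\<close> for the
  block with parameters \<open>t\<close> and \<open>\<nu>\<close>. It is defined through the entries because the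
  summands of a direct sum are given as matrices and not by their parameters.
\<close>

definition joint_spectrum :: "complex mat \<Rightarrow> (complex \<times> complex) multiset" where
  "joint_spectrum C =
    (if dim_row C = 1 then {#(C $$ (0, 0), 2 * of_real ((cmod (C $$ (0, 0)))\<^sup>2))#}
     else let \<mu> = csqrt (C $$ (0, 1) * C $$ (1, 0));
              k = of_real ((cmod (C $$ (0, 1)))\<^sup>2 + (cmod (C $$ (1, 0)))\<^sup>2)
          in {#(\<mu>, k), (- \<mu>, k)#})"

lemma char_poly_2x2:
  fixes M :: "complex mat"
  assumes "M \<in> carrier_mat 2 2" "M $$ (0, 0) = a" "M $$ (0, 1) = b" "M $$ (1, 0) = c" "M $$ (1, 1) = d"
  shows "char_poly M = [:- a, 1:] * [:- d, 1:] - [:b * c:]"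
proof -
  let ?m = "\<lambda>x. mat 1 1 (\<lambda>_. x) :: complex poly mat"
  have eq: "char_poly_matrix M = four_block_mat (?m [:- a, 1:]) (?m [:- b:]) (?m [:- c:]) (?m [:- d, 1:])"
    using assms by (intro eq_matI) (auto simp: char_poly_matrix_def less_Suc_eq)
  have "det (char_poly_matrix M) = det (?m [:- a, 1:] * ?m [:- d, 1:] - ?m [:- b:] * ?m [:- c:])"
    unfolding eq by (rule det_four_block_mat[of _ 1]) (auto intro!: eq_matI simp: scalar_prod_def)
  also have "\<dots> = [:- a, 1:] * [:- d, 1:] - [:b * c:]"
    by (subst det_single) (auto simp: scalar_prod_def)
  finally show ?thesis unfolding char_poly_def .
qed

lemma char_poly_pencil_block:
  assumes "C \<in> complex_blocks"
  shows "char_poly (anticommutator_pencil s C) = (\<Prod>(m, k)\<in>#joint_spectrum C. [:- (m + s * k), 1:])"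
proof -
  consider l where "C = block1 l" | t \<nu> where "C = block2 (complex_of_real t) \<nu>"
    using assms unfolding complex_blocks_def by auto
  then show ?thesis
  proof cases
    case 1
    have c: "anticommutator_pencil s C \<in> carrier_mat 1 1" using 1 by (simp del: One_nat_def)
    have "anticommutator_pencil s C $$ (0, 0) = l + s * (2 * of_real ((cmod l)\<^sup>2))"
      unfolding anticommutator_pencil_def 1
      by (simp add: scalar_prod_def complex_norm_square mult.commute del: of_real_power)
    then show ?thesis
      unfolding char_poly_def by (subst det_single) (use c 1 in \<open>auto simp: joint_spectrum_def char_poly_matrix_def\<close>)
  next
    case 2
    define \<mu> where "\<mu> = csqrt (t * (t * \<nu>))"
    define k :: complex where "k = of_real ((cmod t)\<^sup>2 + (cmod (t * \<nu>))\<^sup>2)"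
    have k: "k = of_real t * of_real t + t * \<nu> * cnj (t * \<nu>)"
      unfolding k_def of_real_add complex_norm_square by simp
    have range: "{0..<2::nat} = {0, 1}" by auto
    let ?P = "anticommutator_pencil s C"
    have P: "?P \<in> carrier_mat 2 2" using 2 by simp
    have "?P $$ (0, 0) = s * k" "?P $$ (1, 1) = s * k" "?P $$ (0, 1) = t" "?P $$ (1, 0) = t * \<nu>"
      by (simp_all add: 2 anticommutator_pencil_def scalar_prod_def range k)
    note char_poly_2x2[OF P this(1,3,4,2)]
    also have "t * (t * \<nu>) = \<mu> * \<mu>"
      using power2_csqrt[of "t * (t * \<nu>)"] unfolding \<mu>_def by (simp add: power2_eq_square)
    also have "[:- (s * k), 1:] * [:- (s * k), 1:] - [:\<mu> * \<mu>:] = [:- (\<mu> + s * k), 1:] * [:- (- \<mu> + s * k), 1:]"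
      by (simp add: algebra_simps)
    finally show ?thesis
      by (simp add: 2 joint_spectrum_def Let_def \<mu>_def k_def)
  qed
qed

lemma char_poly_pencil_complex_sum:
  assumes "set Cs \<subseteq> complex_blocks"
  shows "char_poly (anticommutator_pencil s (diag_block_mat Cs)) =
    (\<Prod>(m, k)\<in>#(\<Sum>C\<in>#mset Cs. joint_spectrum C). [:- (m + s * k), 1:])"
proof -
  have "\<forall>M\<in>set Cs. square_mat M" using assms unfolding complex_blocks_def by auto
  then have "char_poly (anticommutator_pencil s (diag_block_mat Cs)) =
      (\<Prod>C\<leftarrow>Cs. char_poly (anticommutator_pencil s C))"
    by (rule char_poly_pencil_diag_block_mat)
  also have "\<dots> = (\<Prod>C\<leftarrow>Cs. \<Prod>(m, k)\<in>#joint_spectrum C. [:- (m + s * k), 1:])"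
    using assms by (intro arg_cong[where f = prod_list] map_cong refl char_poly_pencil_block) auto
  also have "\<dots> = (\<Prod>(m, k)\<in>#(\<Sum>C\<in>#mset Cs. joint_spectrum C). [:- (m + s * k), 1:])"
    by (induction Cs) auto
  finally show ?thesis .
qed

section \<open>Uniqueness of direct sums of complex blocks\<close>

lemma prod_linear_factors_inject:
  fixes M N :: "complex multiset"
  assumes "(\<Prod>a\<in>#M. [:- a, 1:]) = (\<Prod>a\<in>#N. [:- a, 1:])"
  shows "M = N"
proof -
  have "proots (\<Prod>a\<in>#M. [:- a, 1:]) = M" for M :: "complex multiset"
  proof (induction M)
    case (add a M)
    have "(\<Prod>a\<in>#M. [:- a, 1:]) \<noteq> 0" by (auto simp: prod_mset_zero_iff)
    then show ?case using add by (simp add: proots_mult del: mult_pCons_left)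
  qed auto
  then show ?thesis using assms by metis
qed

lemma image_mset_inj_on_eq:
  assumes "image_mset f M = image_mset f N" "inj_on f (set_mset M \<union> set_mset N)"
  shows "M = N"
proof -
  let ?g = "inv_into (set_mset M \<union> set_mset N) f"
  have "image_mset ?g (image_mset f L) = L" if "set_mset L \<subseteq> set_mset M \<union> set_mset N" for L
    using that by (induction L) (simp_all add: inv_into_f_f[OF assms(2)])
  then show ?thesis using assms(1) by (metis Un_upper1 Un_upper2)
qed

text \<open>
  Two distinct points \<open>(m, k)\<close> are identified by at most one slope \<open>s\<close>, and finitely many
  slopes do not exhaust the complex numbers. A single well-chosen member of the pencil thus
  recovers all joint eigenvalues.
\<close>

lemma exists_separating_slope:
  fixes P :: "(complex \<times> complex) set"
  assumes "finite P"
  shows "\<exists>s. inj_on (\<lambda>(m, k). m + s * k) P"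
proof -
  \<comment> \<open>The only slope that can identify \<open>(m, k)\<close> with \<open>(m', k')\<close>; for \<open>k = k'\<close> it is the harmless value \<open>0\<close>.\<close>
  let ?bad = "(\<lambda>((m, k), (m', k')). (m - m') / (k' - k)) ` (P \<times> P)"
  have "finite ?bad" using assms by simp
  then obtain s where s: "s \<notin> ?bad" using ex_new_if_finite[OF infinite_UNIV_char_0] by blast
  have "inj_on (\<lambda>(m, k). m + s * k) P"
  proof (rule inj_onI, clarify)
    fix m k m' k' assume *: "(m, k) \<in> P" "(m', k') \<in> P" "m + s * k = m' + s * k'"
    then have eq: "m - m' = s * (k' - k)" by (simp add: algebra_simps)
    have "k' = k"
    proof (rule ccontr)
      assume "k' \<noteq> k"
      then have "s = (m - m') / (k' - k)" using eq by simp
      moreover have "(m - m') / (k' - k) \<in> ?bad" using *(1,2) by force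
      ultimately show False using s by metis
    qed
    then show "m = m' \<and> k = k'" using eq by simp
  qed
  then show ?thesis by blast
qed

text \<open>
  If every \<open>f x\<close> contains an element \<open>r x\<close> that occurs in no other piece, the multiplicity of
  \<open>x\<close> can be read off from that of \<open>r x\<close> in the union of the pieces. This is used for complex
  blocks with their joint spectra, and again for real blocks with the complex blocks they split into.
\<close>

lemma mset_eq_by_pieces:
  assumes "set_mset M \<subseteq> S" "set_mset N \<subseteq> S"
    and "\<And>x. x \<in> S \<Longrightarrow> r x \<in># f x"
    and "\<And>x y. x \<in> S \<Longrightarrow> y \<in> S \<Longrightarrow> r x \<in># f y \<Longrightarrow> x = y"
    and "(\<Sum>x\<in>#M. f x) = (\<Sum>x\<in>#N. f x)"
  shows "M = N"
proof (rule multiset_eqI)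
  fix x
  show "count M x = count N x"
  proof (cases "x \<in> S")
    case True
    have "count (\<Sum>y\<in>#L. f y) (r x) = count L x * count (f x) (r x)" if "set_mset L \<subseteq> S" for L
      using that
    proof (induction L)
      case (add y L)
      have "count (f y) (r x) = 0" if "x \<noteq> y"
        using assms(4)[OF True, of y] add.prems that by (auto simp: count_eq_zero_iff)
      then show ?case using add by auto
    qed auto
    then have "count M x * count (f x) (r x) = count N x * count (f x) (r x)"
      using assms(1,2,5) by metis
    moreover have "count (f x) (r x) \<noteq> 0" using assms(3)[OF True] by auto
    ultimately show ?thesis by simp
  next
    case False
    then show ?thesis using assms(1,2) by (metis count_eq_zero_iff subsetD)
  qed
qed

text \<open>
  A distinguished member of \<^const>\<open>joint_spectrum\<close> that identifies the block.
\<close>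

definition leading_joint_eigenvalue :: "complex mat \<Rightarrow> complex \<times> complex" where
  "leading_joint_eigenvalue C =
    (if dim_row C = 1 then (C $$ (0, 0), 2 * of_real ((cmod (C $$ (0, 0)))\<^sup>2))
     else (csqrt (C $$ (0, 1) * C $$ (1, 0)),
           of_real ((cmod (C $$ (0, 1)))\<^sup>2 + (cmod (C $$ (1, 0)))\<^sup>2)))"

text \<open>
  With \<open>a = t\<^sup>2\<close> and \<open>x = t\<^sup>2 y\<close> fixed, the number \<open>a + x\<^sup>2 / a\<close> determines \<open>a\<close> up to exchanging
  \<open>a\<close> with \<open>x\<^sup>2 / a\<close>, and \<open>y < 1\<close> says that \<open>a\<close> is the larger of the two. Here \<open>y\<close> stands for the
  absolute value of \<open>\<nu>\<close>.
\<close>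

lemma block2_parameter_unique:
  fixes t t' y y' :: real
  assumes "t > 0" "t' > 0" "0 \<le> y" "y < 1" "0 \<le> y'" "y' < 1"
    and "t\<^sup>2 * y = t'\<^sup>2 * y'" and "t\<^sup>2 + (t * y)\<^sup>2 = t'\<^sup>2 + (t' * y')\<^sup>2"
  shows "t = t'"
proof -
  define a b where "a = t\<^sup>2" and "b = t'\<^sup>2"
  have ab: "a > 0" "b > 0" "a * y = b * y'" and eq: "a + a * y\<^sup>2 = b + b * y'\<^sup>2"
    using assms by (auto simp: a_def b_def power_mult_distrib)
  have "(a - b) * (1 - y * y') = 0"
  proof -
    have "a * y\<^sup>2 = b * y' * y" "b * y'\<^sup>2 = a * y * y'"
      using ab(3) by (auto simp: power2_eq_square)
    then show ?thesis using eq by (simp add: algebra_simps)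
  qed
  moreover have "y * y' < 1"
    using mult_strict_mono'[of y 1 y' 1] assms by simp
  ultimately have "a = b" by simp
  then show ?thesis using assms(1,2) unfolding a_def b_def by (simp add: power2_eq_iff)
qed

text \<open>
  A joint eigenvalue \<open>(m, k)\<close> of a \<open>1 \<times> 1\<close> block satisfies \<open>k = 2 \<bar>m\<bar>\<^sup>2\<close>, whereas a \<open>2 \<times> 2\<close>
  block has \<open>k - 2 \<bar>m\<bar>\<^sup>2 = t\<^sup>2 (1 - \<bar>\<nu>\<bar>)\<^sup>2\<close>, which is positive.
\<close>

lemma block2_separated_from_block1:
  fixes t y m :: real
  assumes "t > 0" "0 \<le> y" "y < 1" "m\<^sup>2 = t\<^sup>2 * y" "2 * m\<^sup>2 = t\<^sup>2 + (t * y)\<^sup>2"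
  shows False
proof -
  have "t\<^sup>2 * (1 - y)\<^sup>2 = 0"
    using assms(4,5) by (simp add: power2_eq_square algebra_simps)
  then show False using assms(1,3) by simp
qed

lemma leading_joint_eigenvalue_determines_block:
  assumes "B \<in> complex_blocks" "C \<in> complex_blocks" "leading_joint_eigenvalue B \<in># joint_spectrum C"
  shows "B = C"
proof -
  consider l where "B = block1 l" | t \<nu> where "B = block2 (complex_of_real t) \<nu>" "t > 0" "cmod \<nu> < 1"
    using assms(1) unfolding complex_blocks_def by auto
  then show ?thesis
  proof cases
    case B: 1
    consider l' where "C = block1 l'" | t \<nu> where "C = block2 (complex_of_real t) \<nu>" "t > 0" "cmod \<nu> < 1"
      using assms(2) unfolding complex_blocks_def by auto
    then show ?thesis
    proof cases
      case 1
      then show ?thesis using assms(3) B by (simp add: leading_joint_eigenvalue_def joint_spectrum_def)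
    next
      case 2
      define \<mu> where "\<mu> = csqrt (t * (t * \<nu>))"
      have "cmod \<mu> ^ 2 = cmod (t * (t * \<nu>))" unfolding \<mu>_def by (metis norm_power power2_csqrt)
      moreover have "cmod l = cmod \<mu>" and "2 * of_real ((cmod l)\<^sup>2) = complex_of_real ((cmod t)\<^sup>2 + (cmod (t * \<nu>))\<^sup>2)"
        using assms(3) 2 B by (auto simp: leading_joint_eigenvalue_def joint_spectrum_def Let_def \<mu>_def)
      moreover from this(2) have "2 * (cmod l)\<^sup>2 = (cmod t)\<^sup>2 + (cmod (t * \<nu>))\<^sup>2"
        by (metis of_real_eq_iff of_real_mult of_real_numeral)
      ultimately show ?thesis
        using block2_separated_from_block1[of t "cmod \<nu>" "cmod l"] 2
        by (simp add: norm_mult power2_eq_square)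
    qed
  next
    case B: 2
    define \<mu> where "\<mu> = csqrt (t * (t * \<nu>))"
    have \<mu>: "\<mu>\<^sup>2 = t * (t * \<nu>)" unfolding \<mu>_def by simp
    consider l' where "C = block1 l'" | t' \<nu>' where "C = block2 (complex_of_real t') \<nu>'" "t' > 0" "cmod \<nu>' < 1"
      using assms(2) unfolding complex_blocks_def by auto
    then show ?thesis
    proof cases
      case 1
      have "cmod \<mu> ^ 2 = cmod (t * (t * \<nu>))" using \<mu> by (metis norm_power)
      moreover have "cmod l' = cmod \<mu>" and "2 * of_real ((cmod l')\<^sup>2) = complex_of_real ((cmod t)\<^sup>2 + (cmod (t * \<nu>))\<^sup>2)"
        using assms(3) 1 B by (auto simp: leading_joint_eigenvalue_def joint_spectrum_def Let_def \<mu>_def)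
      moreover from this(2) have "2 * (cmod l')\<^sup>2 = (cmod t)\<^sup>2 + (cmod (t * \<nu>))\<^sup>2"
        by (metis of_real_eq_iff of_real_mult of_real_numeral)
      ultimately show ?thesis
        using block2_separated_from_block1[of t "cmod \<nu>" "cmod l'"] B
        by (simp add: norm_mult power2_eq_square)
    next
      case 2
      define \<mu>' where "\<mu>' = csqrt (t' * (t' * \<nu>'))"
      have \<mu>': "\<mu>'\<^sup>2 = t' * (t' * \<nu>')" unfolding \<mu>'_def by simp
      have "\<mu> = \<mu>' \<or> \<mu> = - \<mu>'"
        and k: "complex_of_real ((cmod t)\<^sup>2 + (cmod (t * \<nu>))\<^sup>2) = complex_of_real ((cmod t')\<^sup>2 + (cmod (t' * \<nu>'))\<^sup>2)"
        using assms(3) 2 B by (auto simp: leading_joint_eigenvalue_def joint_spectrum_def Let_def \<mu>_def \<mu>'_def)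
      then have x: "t * (t * \<nu>) = t' * (t' * \<nu>')" using \<mu> \<mu>' by auto
      have k': "(cmod t)\<^sup>2 + (cmod (t * \<nu>))\<^sup>2 = (cmod t')\<^sup>2 + (cmod (t' * \<nu>'))\<^sup>2"
        using k by (simp only: of_real_eq_iff)
      have "t = t'"
        using block2_parameter_unique[of t t' "cmod \<nu>" "cmod \<nu>'"] k' arg_cong[OF x, of cmod] B 2
        by (simp add: norm_mult power2_eq_square)
      then show ?thesis using x B 2 by (simp add: block2_eq_iff)
    qed
  qed
qed

text \<open>
  Uniqueness of the complex canonical form: the hypothesis holds whenever the two direct sums are
  unitarily similar to the same matrix, or split the same real matrix.
\<close>

lemma complex_sum_determined_by_pencil:
  assumes "set Cs \<subseteq> complex_blocks" "set Ds \<subseteq> complex_blocks"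
    and "\<And>s. char_poly (anticommutator_pencil s (diag_block_mat Cs)) =
      char_poly (anticommutator_pencil s (diag_block_mat Ds))"
  shows "mset Cs = mset Ds"
proof -
  let ?J = "\<lambda>Cs. \<Sum>C\<in>#mset Cs. joint_spectrum C"
  have "finite (set_mset (?J Cs) \<union> set_mset (?J Ds))" by blast
  then obtain s where s: "inj_on (\<lambda>(m, k). m + s * k) (set_mset (?J Cs) \<union> set_mset (?J Ds))"
    using exists_separating_slope by blast
  let ?\<phi> = "\<lambda>(m, k). m + s * k"
  have prod: "char_poly (anticommutator_pencil s (diag_block_mat Cs)) = (\<Prod>a\<in>#image_mset ?\<phi> (?J Cs). [:- a, 1:])"
    if "set Cs \<subseteq> complex_blocks" for Cs
    unfolding char_poly_pencil_complex_sum[OF that]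
    by (simp add: multiset.map_comp comp_def case_prod_unfold)
  have "image_mset ?\<phi> (?J Cs) = image_mset ?\<phi> (?J Ds)"
    using prod[OF assms(1)] prod[OF assms(2)] assms(3)[of s] by (intro prod_linear_factors_inject) simp
  then have eq: "?J Cs = ?J Ds" using s by (rule image_mset_inj_on_eq)
  have mem: "leading_joint_eigenvalue C \<in># joint_spectrum C" for C
    by (simp add: leading_joint_eigenvalue_def joint_spectrum_def Let_def)
  show ?thesis
  proof (rule mset_eq_by_pieces[where S = complex_blocks and r = leading_joint_eigenvalue and f = joint_spectrum])
    show "set_mset (mset Cs) \<subseteq> complex_blocks" "set_mset (mset Ds) \<subseteq> complex_blocks"
      using assms(1,2) by (simp_all only: set_mset_mset)
    show "?J Cs = ?J Ds" by (fact eq)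
  qed (auto intro: mem leading_joint_eigenvalue_determines_block)
qed

section \<open>Eigenvectors in invariant sets and Fuglede's theorem\<close>

lemma vec_eq_of_diff_eq_0:
  fixes v w :: "'a :: ab_group_add vec"
  assumes "v \<in> carrier_vec n" "w \<in> carrier_vec n" "v - w = 0\<^sub>v n"
  shows "v = w"
proof (rule eq_vecI)
  fix i assume "i < dim_vec w"
  then have i: "i < n" using assms by auto
  have "(v - w) $ i = 0" using i unfolding assms(3) by simp
  then show "v $ i = w $ i" using i assms(1,2) by auto
qed (use assms in auto)

lemma mat_eq_of_diff_eq_0:
  fixes M N :: "'a :: ab_group_add mat"
  assumes "M \<in> carrier_mat n m" "N \<in> carrier_mat n m" "M - N = 0\<^sub>m n m"
  shows "M = N"
proof (rule eq_matI)
  fix i j assume "i < dim_row N" "j < dim_col N"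
  then have ij: "i < n" "j < m" using assms by auto
  have "(M - N) $$ (i, j) = 0" using ij unfolding assms(3) by simp
  then show "M $$ (i, j) = N $$ (i, j)" using ij assms(1,2) by auto
qed (use assms in auto)

text \<open>
  An eigenvector inside a nonzero set \<open>P\<close> that is closed under all \<open>M - c\<close>. After Schur
  triangularisation, applying \<open>U - U\<^bsub>jj\<^esub>\<close> to a vector supported on the first \<open>j + 1\<close> coordinates
  leaves one supported on the first \<open>j\<close>. Starting from any vector of \<open>P\<close> this must reach zero, and
  the last nonzero vector of the chain is an eigenvector. With eigenspaces of commuting matrices
  as \<open>P\<close> it yields common eigenvectors.
\<close>

lemma invariant_eigenvector:
  fixes M :: "complex mat"
  assumes M: "M \<in> carrier_mat n n"
    and v: "v \<in> carrier_vec n" "v \<noteq> 0\<^sub>v n" "P v"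
    and closed: "\<And>w c. w \<in> carrier_vec n \<Longrightarrow> P w \<Longrightarrow> P (M *\<^sub>v w - c \<cdot>\<^sub>v w)"
  obtains w c where "w \<in> carrier_vec n" "w \<noteq> 0\<^sub>v n" "P w" "M *\<^sub>v w = c \<cdot>\<^sub>v w"
proof -
  obtain es where "char_poly M = (\<Prod>e\<leftarrow>es. [:- e, 1:])" using char_poly_factorized[OF M] by blast
  then obtain U where U: "U \<in> carrier_mat n n" "upper_triangular U" and "similar_mat M U"
    using schur_decomposition_exists[OF M] by blast
  then obtain S T where "similar_mat_wit M U S T" unfolding similar_mat_def by blast
  note sim = similar_mat_witD2[OF M this]
  have MS: "M * S = S * U"
    unfolding sim(3) using sim U by (simp add: square_mat_simps[where n = n])
  have "\<exists>w c. w \<in> carrier_vec n \<and> w \<noteq> 0\<^sub>v n \<and> P w \<and> M *\<^sub>v w = c \<cdot>\<^sub>v w"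
    if "x \<in> carrier_vec n" "S *\<^sub>v x \<noteq> 0\<^sub>v n" "P (S *\<^sub>v x)" "j \<le> n" "\<And>i. j \<le> i \<Longrightarrow> i < n \<Longrightarrow> x $ i = 0" for j x
    using that
  proof (induction j arbitrary: x)
    case 0
    then have "x = 0\<^sub>v n" by (intro eq_vecI) auto
    then show ?case using 0 sim by auto
  next
    case (Suc j)
    let ?d = "U $$ (j, j)"
    \<comment> \<open>Subtracting the \<open>j\<close>th diagonal entry kills coordinate \<open>j\<close>, the last one in the support.\<close>
    let ?y = "U *\<^sub>v x - ?d \<cdot>\<^sub>v x"
    have y: "?y \<in> carrier_vec n" using Suc.prems(1) U by auto
    have "S *\<^sub>v ?y = S *\<^sub>v (U *\<^sub>v x) - ?d \<cdot>\<^sub>v (S *\<^sub>v x)"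
      using mult_minus_distrib_mat_vec[OF sim(6), of "U *\<^sub>v x" "?d \<cdot>\<^sub>v x"] mult_mat_vec[OF sim(6), of x ?d]
        mult_mat_vec_carrier[OF U(1) Suc.prems(1)] Suc.prems(1) by simp
    also have "S *\<^sub>v (U *\<^sub>v x) = M *\<^sub>v (S *\<^sub>v x)"
      using assoc_mult_mat_vec[OF M sim(6) Suc.prems(1)] assoc_mult_mat_vec[OF sim(6) U(1) Suc.prems(1)] MS
      by simp
    finally have Sy: "S *\<^sub>v ?y = M *\<^sub>v (S *\<^sub>v x) - ?d \<cdot>\<^sub>v (S *\<^sub>v x)" .
    have Sx: "S *\<^sub>v x \<in> carrier_vec n" using sim Suc.prems(1) by auto
    show ?case
    proof (cases "S *\<^sub>v ?y = 0\<^sub>v n")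
      case True
      have "M *\<^sub>v (S *\<^sub>v x) = ?d \<cdot>\<^sub>v (S *\<^sub>v x)"
        by (rule vec_eq_of_diff_eq_0[of _ n]) (use True Sy Sx M in \<open>simp_all only: mult_mat_vec_carrier smult_carrier_vec\<close>)
      then show ?thesis using Sx Suc.prems by blast
    next
      case False
      have "?y $ i = 0" if "j \<le> i" "i < n" for i
      proof -
        have "(U *\<^sub>v x) $ i = (\<Sum>k\<in>{0..<n}. U $$ (i, k) * x $ k)"
          using U Suc.prems(1) that by (auto simp: scalar_prod_def)
        also have "\<dots> = (\<Sum>k\<in>{0..<n}. if k = j then U $$ (i, j) * x $ j else 0)"
        proof (rule sum.cong)
          fix k assume k: "k \<in> {0..<n}"
          show "U $$ (i, k) * x $ k = (if k = j then U $$ (i, j) * x $ j else 0)"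
          proof (cases "k < j")
            case True
            then have "U $$ (i, k) = 0" using that U(1) by (intro upper_triangularD[OF U(2)]) auto
            then show ?thesis using True by simp
          next
            case False
            then show ?thesis using Suc.prems(5)[of k] k by (cases "k = j") auto
          qed
        qed simp
        also have "\<dots> = U $$ (i, j) * x $ j" using Suc.prems(4) by simp
        finally have *: "(U *\<^sub>v x) $ i = U $$ (i, j) * x $ j" .
        show ?thesis
        proof (cases "i = j")
          case True
          then show ?thesis using * that Suc.prems(1) U by simp
        next
          case False
          then have "U $$ (i, j) = 0" using that U(1) by (intro upper_triangularD[OF U(2)]) auto
          moreover have "x $ i = 0" using Suc.prems(5)[of i] that False by simp
          ultimately show ?thesis using * that Suc.prems(1) U by simp
        qed
      qed
      moreover have "P (S *\<^sub>v ?y)" unfolding Sy using Sx Suc.prems(3) by (rule closed)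
      ultimately show ?thesis using Suc.IH[OF y False] Suc.prems(4) by simp
    qed
  qed
  note step = this
  have "S *\<^sub>v (T *\<^sub>v v) = v"
    using assoc_mult_mat_vec[OF sim(6,7) v(1)] sim(1) v(1) by simp
  moreover have "T *\<^sub>v v \<in> carrier_vec n" using sim v(1) by auto
  ultimately show thesis using step[of "T *\<^sub>v v" n] v that by auto
qed

definition mat_trace :: "'a :: comm_ring_1 mat \<Rightarrow> 'a" where
  "mat_trace M = (\<Sum>i<dim_row M. M $$ (i, i))"

lemma mat_trace_comm:
  assumes "M \<in> carrier_mat n n" "N \<in> carrier_mat n n"
  shows "mat_trace (M * N) = mat_trace (N * M)"
proof -
  have "mat_trace (M * N) = (\<Sum>i<n. \<Sum>k<n. M $$ (i, k) * N $$ (k, i))"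
    using assms by (simp add: mat_trace_def scalar_prod_def atLeast0LessThan)
  also have "\<dots> = (\<Sum>k<n. \<Sum>i<n. N $$ (k, i) * M $$ (i, k))"
    by (subst sum.swap) (simp add: mult.commute)
  also have "\<dots> = mat_trace (N * M)"
    using assms by (simp add: mat_trace_def scalar_prod_def atLeast0LessThan)
  finally show ?thesis .
qed

lemma mat_trace_diff:
  assumes "M \<in> carrier_mat n n" "N \<in> carrier_mat n n"
  shows "mat_trace (M - N) = mat_trace M - mat_trace N"
  using assms by (simp add: mat_trace_def sum_subtractf)

lemma mat_trace_adjoint_mult_eq_0:
  fixes M :: "complex mat"
  assumes M: "M \<in> carrier_mat n n" and "mat_trace (mat_adjoint M * M) = 0"
  shows "M = 0\<^sub>m n n"
proof -
  have "mat_trace (mat_adjoint M * M) = (\<Sum>i<n. \<Sum>k<n. cnj (M $$ (k, i)) * M $$ (k, i))"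
    using M by (simp add: mat_trace_def scalar_prod_def atLeast0LessThan)
  also have "\<dots> = (\<Sum>i<n. \<Sum>k<n. of_real ((cmod (M $$ (k, i)))\<^sup>2))"
    by (simp only: complex_norm_square mult.commute)
  also have "\<dots> = of_real (\<Sum>i<n. \<Sum>k<n. (cmod (M $$ (k, i)))\<^sup>2)" by simp
  finally have "(\<Sum>i<n. \<Sum>k<n. (cmod (M $$ (k, i)))\<^sup>2) = 0" using assms(2) by (metis of_real_eq_0_iff)
  then have "\<forall>i<n. \<forall>k<n. M $$ (k, i) = 0"
    by (subst (asm) sum_nonneg_eq_0_iff; (intro sum_nonneg)?; simp add: sum_nonneg_eq_0_iff)
  then show ?thesis using M by (intro eq_matI) auto
qed

text \<open>
  The finite-dimensional proof: by cyclicity of the trace and normality of \<open>N\<close>, the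
  Hilbert-Schmidt norm of \<open>N\<^sup>* M - M N\<^sup>*\<close> vanishes together with \<open>N M - M N\<close>.
\<close>

theorem Fuglede:
  fixes N M :: "complex mat"
  assumes N: "N \<in> carrier_mat n n" "normal_mat N" and M: "M \<in> carrier_mat n n" and comm: "N * M = M * N"
  shows "mat_adjoint N * M = M * mat_adjoint N"
proof -
  let ?N = "mat_adjoint N" and ?M = "mat_adjoint M"
  have c [simp]: "?N \<in> carrier_mat n n" "?M \<in> carrier_mat n n" "N \<in> carrier_mat n n" "M \<in> carrier_mat n n"
    using assms by auto
  note [simp] = square_mat_simps(4)[where n = n]
  have normal: "?N * N = N * ?N" using N(2) unfolding normal_mat_def .
  let ?D = "?N * M - M * ?N"
  have D: "?D \<in> carrier_mat n n" by (rule minus_carrier_mat) simp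
  have adj: "mat_adjoint ?D = ?M * N - N * ?M"
    using adjoint_minus[of "?N * M" n n "M * ?N"] adjoint_mult[OF c(1,4)] adjoint_mult[OF c(4,1)] by simp
  have exp: "mat_adjoint ?D * ?D = (?M * N * (?N * M) - N * ?M * (?N * M)) - (?M * N * (M * ?N) - N * ?M * (M * ?N))"
    unfolding adj
    using D by (simp add: mult_minus_distrib_mat[of _ n n _ n] minus_mult_distrib_mat[of _ n n _ _ n] minus_carrier_mat[of _ n n] del: assoc_mult_mat)
  have 1: "mat_trace (?M * N * (?N * M)) = mat_trace (N * ?M * (?N * M))"
  proof -
    have "?M * N * (?N * M) = ?M * (N * ?N) * M" by (simp add: square_mat_simps[where n = n])
    also have "\<dots> = ?M * ?N * (N * M)" unfolding normal[symmetric] by (simp add: square_mat_simps[where n = n])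
    also have "\<dots> = (?M * ?N * M) * N" unfolding comm by (simp add: square_mat_simps[where n = n])
    finally have "mat_trace (?M * N * (?N * M)) = mat_trace (N * (?M * ?N * M))"
      using mat_trace_comm[of "?M * ?N * M" n N] by simp
    then show ?thesis by (simp add: square_mat_simps[where n = n])
  qed
  have 2: "mat_trace (N * ?M * (M * ?N)) = mat_trace (?M * N * (M * ?N))"
  proof -
    have "mat_trace (N * ?M * (M * ?N)) = mat_trace (N * (?M * M * ?N))"
      by (simp add: square_mat_simps[where n = n])
    also have "\<dots> = mat_trace (?M * M * ?N * N)" by (rule mat_trace_comm[of _ n]) simp_all
    also have "?M * M * ?N * N = ?M * M * (N * ?N)" unfolding normal[symmetric] by (simp add: square_mat_simps[where n = n])
    also have "\<dots> = ?M * (N * M) * ?N" unfolding comm by (simp add: square_mat_simps[where n = n])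
    finally show ?thesis by (simp add: square_mat_simps[where n = n])
  qed
  have c4: "?M * N * (?N * M) \<in> carrier_mat n n" "N * ?M * (?N * M) \<in> carrier_mat n n"
    "?M * N * (M * ?N) \<in> carrier_mat n n" "N * ?M * (M * ?N) \<in> carrier_mat n n"
    by simp_all
  have "mat_trace (mat_adjoint ?D * ?D) = 0"
    unfolding exp mat_trace_diff[OF minus_carrier_mat[OF c4(2)] minus_carrier_mat[OF c4(4)]]
      mat_trace_diff[OF c4(1,2)] mat_trace_diff[OF c4(3,4)] 1 2
    by simp
  then have "?D = 0\<^sub>m n n" using mat_trace_adjoint_mult_eq_0[OF D] by simp
  then show ?thesis by (rule mat_eq_of_diff_eq_0[OF mult_carrier_mat[OF c(1,4)] mult_carrier_mat[OF c(4,1)]])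
qed

section \<open>Joint eigenvectors of a matrix with normal square\<close>

lemma adjoint_cscalar_prod:
  fixes M :: "complex mat"
  assumes "M \<in> carrier_mat n n" "v \<in> carrier_vec n" "w \<in> carrier_vec n"
  shows "(M *\<^sub>v v) \<bullet>c w = v \<bullet>c (mat_adjoint M *\<^sub>v w)"
proof -
  have "(M *\<^sub>v v) \<bullet>c w = (\<Sum>i<n. \<Sum>k<n. M $$ (i, k) * v $ k * cnj (w $ i))"
    using assms by (simp add: scalar_prod_def atLeast0LessThan sum_distrib_right)
  also have "\<dots> = (\<Sum>k<n. \<Sum>i<n. v $ k * (M $$ (i, k) * cnj (w $ i)))"
    by (subst sum.swap) (simp add: mult_ac)
  also have "\<dots> = v \<bullet>c (mat_adjoint M *\<^sub>v w)"
    using assms by (simp add: scalar_prod_def atLeast0LessThan sum_distrib_left)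
  finally show ?thesis .
qed

lemma cscalar_prod_smult_right:
  fixes v w :: "complex vec"
  assumes "v \<in> carrier_vec n" "w \<in> carrier_vec n"
  shows "v \<bullet>c (c \<cdot>\<^sub>v w) = cnj c * (v \<bullet>c w)"
  using assms by (simp add: conjugate_smult_vec)

lemma cscalar_prod_smult_left:
  fixes v w :: "complex vec"
  assumes "v \<in> carrier_vec n" "w \<in> carrier_vec n"
  shows "(c \<cdot>\<^sub>v v) \<bullet>c w = c * (v \<bullet>c w)"
  using assms by simp

lemma conjugate_minus_vec:
  fixes v w :: "complex vec"
  assumes "v \<in> carrier_vec n" "w \<in> carrier_vec n"
  shows "conjugate (v - w) = conjugate v - conjugate w"
  using assms by (intro eq_vecI) auto

text \<open>
  If \<open>M\<close> and its adjoint commute at the single vector \<open>v\<close>, then expanding the square shows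
  \<open>\<parallel>M\<^sup>* v - cnj l v\<parallel>\<^sup>2 = \<parallel>M v - l v\<parallel>\<^sup>2\<close>. The local hypothesis matters, because the statement is also
  applied to matrices that are normal on an invariant subspace only.
\<close>

lemma adjoint_eigenvector:
  fixes M :: "complex mat"
  assumes M: "M \<in> carrier_mat n n" and v: "v \<in> carrier_vec n"
    and normal: "mat_adjoint M *\<^sub>v (M *\<^sub>v v) = M *\<^sub>v (mat_adjoint M *\<^sub>v v)"
    and eig: "M *\<^sub>v v = l \<cdot>\<^sub>v v"
  shows "mat_adjoint M *\<^sub>v v = cnj l \<cdot>\<^sub>v v"
proof -
  define a where "a = mat_adjoint M *\<^sub>v v"
  have Ma: "mat_adjoint M \<in> carrier_mat n n" using M by simp
  have a: "a \<in> carrier_vec n" unfolding a_def by (rule mult_mat_vec_carrier[OF Ma v])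
  have Mv: "M *\<^sub>v v \<in> carrier_vec n" by (rule mult_mat_vec_carrier[OF M v])
  have "a \<bullet>c v = v \<bullet>c (M *\<^sub>v v)"
    unfolding a_def using adjoint_cscalar_prod[OF Ma v v] by simp
  then have av: "a \<bullet>c v = cnj l * (v \<bullet>c v)" unfolding eig using cscalar_prod_smult_right[OF v v] by simp
  have "v \<bullet>c a = (M *\<^sub>v v) \<bullet>c v"
    unfolding a_def using adjoint_cscalar_prod[OF M v v] by simp
  then have va: "v \<bullet>c a = l * (v \<bullet>c v)" unfolding eig using cscalar_prod_smult_left[OF v v] by simp
  have "a \<bullet>c a = v \<bullet>c (M *\<^sub>v a)"
    unfolding a_def using adjoint_cscalar_prod[OF Ma v a[unfolded a_def]] by simp
  also have "\<dots> = (M *\<^sub>v v) \<bullet>c (M *\<^sub>v v)"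
    unfolding a_def normal[symmetric] using adjoint_cscalar_prod[OF M v Mv] by simp
  also have "\<dots> = l * cnj l * (v \<bullet>c v)"
    unfolding eig using v by (simp add: cscalar_prod_smult_right[of _ n] cscalar_prod_smult_left[of _ n])
  finally have aa: "a \<bullet>c a = l * cnj l * (v \<bullet>c v)" .
  let ?u = "a - cnj l \<cdot>\<^sub>v v"
  have cv: "cnj l \<cdot>\<^sub>v v \<in> carrier_vec n" using v by simp
  have u: "?u \<in> carrier_vec n" using a cv by (rule minus_carrier_vec)
  have "?u \<bullet>c ?u = a \<bullet>c a - (cnj l \<cdot>\<^sub>v v) \<bullet>c a - (a \<bullet>c (cnj l \<cdot>\<^sub>v v) - (cnj l \<cdot>\<^sub>v v) \<bullet>c (cnj l \<cdot>\<^sub>v v))"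
    unfolding conjugate_minus_vec[OF a cv]
    using a cv by (simp add: scalar_prod_minus_distrib[of _ n] minus_scalar_prod_distrib[of _ n])
  also have "\<dots> = 0"
    using a v by (simp add: cscalar_prod_smult_right[of _ n] cscalar_prod_smult_left[of _ n] aa av va)
  finally have "?u = 0\<^sub>v n" using conjugate_square_eq_0_vec[OF u] by simp
  then show ?thesis using vec_eq_of_diff_eq_0[OF a cv] unfolding a_def by simp
qed

lemma eigenspace_invariant:
  fixes X M :: "complex mat"
  assumes "X \<in> carrier_mat n n" "M \<in> carrier_mat n n" "X * M = M * X" "w \<in> carrier_vec n"
    and eig: "X *\<^sub>v w = x \<cdot>\<^sub>v w"
  shows "X *\<^sub>v (M *\<^sub>v w - c \<cdot>\<^sub>v w) = x \<cdot>\<^sub>v (M *\<^sub>v w - c \<cdot>\<^sub>v w)"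
proof -
  have Mw: "M *\<^sub>v w \<in> carrier_vec n" by (rule mult_mat_vec_carrier[OF assms(2,4)])
  have "X *\<^sub>v (M *\<^sub>v w) = M *\<^sub>v (X *\<^sub>v w)"
    using assoc_mult_mat_vec[OF assms(1,2,4)] assoc_mult_mat_vec[OF assms(2,1,4)] assms(3) by simp
  also have "\<dots> = x \<cdot>\<^sub>v (M *\<^sub>v w)" unfolding eig by (rule mult_mat_vec[OF assms(2,4)])
  finally have 1: "X *\<^sub>v (M *\<^sub>v w) = x \<cdot>\<^sub>v (M *\<^sub>v w)" .
  have 2: "X *\<^sub>v (c \<cdot>\<^sub>v w) = c \<cdot>\<^sub>v (x \<cdot>\<^sub>v w)" unfolding mult_mat_vec[OF assms(1,4)] eig ..
  have scale: "x \<cdot>\<^sub>v y - c \<cdot>\<^sub>v (x \<cdot>\<^sub>v w) = x \<cdot>\<^sub>v (y - c \<cdot>\<^sub>v w)" if "y \<in> carrier_vec n" for y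
    using that assms(4) by (intro eq_vecI) (auto simp: algebra_simps)
  have cw: "c \<cdot>\<^sub>v w \<in> carrier_vec n" using assms(4) by simp
  show ?thesis
    unfolding mult_minus_distrib_mat_vec[OF assms(1) Mw cw] 1 2
    using scale[OF Mw] .
qed

locale normal_square =
  fixes A :: "complex mat" and n :: nat
  assumes A: "A \<in> carrier_mat n n" and normal: "normal_mat (A ^\<^sub>m 2)"
begin

abbreviation "Ad \<equiv> mat_adjoint A"

lemma Ad: "Ad \<in> carrier_mat n n" using A by simp

lemma A_carrier: "v \<in> carrier_vec n \<Longrightarrow> A *\<^sub>v v \<in> carrier_vec n"
  by (rule mult_mat_vec_carrier[OF A])

lemma Ad_carrier: "v \<in> carrier_vec n \<Longrightarrow> Ad *\<^sub>v v \<in> carrier_vec n"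
  by (rule mult_mat_vec_carrier[OF Ad])

lemma A_smult: "v \<in> carrier_vec n \<Longrightarrow> A *\<^sub>v (c \<cdot>\<^sub>v v) = c \<cdot>\<^sub>v (A *\<^sub>v v)"
  by (rule mult_mat_vec[OF A])

lemma Ad_smult: "v \<in> carrier_vec n \<Longrightarrow> Ad *\<^sub>v (c \<cdot>\<^sub>v v) = c \<cdot>\<^sub>v (Ad *\<^sub>v v)"
  by (rule mult_mat_vec[OF Ad])

lemma AA: "A * A \<in> carrier_mat n n" and AdA: "Ad * A \<in> carrier_mat n n" and AAd: "A * Ad \<in> carrier_mat n n"
  and AdAd: "Ad * Ad \<in> carrier_mat n n"
  using A Ad by auto

lemma adjoint_AA: "mat_adjoint (A * A) = Ad * Ad"
  by (rule adjoint_mult[OF A A])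

lemma normal_AA: "normal_mat (A * A)"
  using normal unfolding pow_mat_two[OF A] .

text \<open>
  \<open>A\<close> commutes with its normal square, hence by Fuglede's theorem also with the adjoint of the square.
\<close>

lemma Ad_Ad_A: "Ad * (Ad * A) = A * (Ad * Ad)"
proof -
  have "A * A * A = A * (A * A)" using A by simp
  then have "Ad * Ad * A = A * (Ad * Ad)"
    using Fuglede[OF AA normal_AA A] unfolding adjoint_AA by simp
  then show ?thesis using A Ad by (simp add: square_mat_simps[where n = n])
qed

lemma Ad_A_A: "Ad * (A * A) = A * (A * Ad)"
proof -
  have "mat_adjoint (Ad * (Ad * A)) = Ad * A * A" "mat_adjoint (A * (Ad * Ad)) = A * A * Ad"
    using adjoint_mult[OF Ad AdA] adjoint_mult[OF Ad A] adjoint_mult[OF A AdAd] adjoint_mult[OF Ad Ad] by simp_all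
  then have "Ad * A * A = A * A * Ad" using Ad_Ad_A by simp
  then show ?thesis using A Ad by (simp add: square_mat_simps[where n = n])
qed

text \<open>
  A common eigenvector of \<open>A\<^sup>2\<close>, \<open>A\<^sup>* A\<close> and \<open>A A\<^sup>*\<close> with eigenvalues \<open>x\<close>, \<open>s\<close> and \<open>r\<close>. The
  zero vector is admitted, so that for fixed eigenvalues this is a subspace.
\<close>

definition joint_eigenvector :: "complex \<Rightarrow> complex \<Rightarrow> complex \<Rightarrow> complex vec \<Rightarrow> bool" where
  "joint_eigenvector x s r v \<longleftrightarrow> v \<in> carrier_vec n \<and> A *\<^sub>v (A *\<^sub>v v) = x \<cdot>\<^sub>v v \<and>
    Ad *\<^sub>v (A *\<^sub>v v) = s \<cdot>\<^sub>v v \<and> A *\<^sub>v (Ad *\<^sub>v v) = r \<cdot>\<^sub>v v"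

lemma Ad_A_A_vec: "v \<in> carrier_vec n \<Longrightarrow> Ad *\<^sub>v (A *\<^sub>v (A *\<^sub>v v)) = A *\<^sub>v (A *\<^sub>v (Ad *\<^sub>v v))"
  using arg_cong[OF Ad_A_A, of "\<lambda>M. M *\<^sub>v v"] assoc_mult_mat_vec[OF Ad AA] assoc_mult_mat_vec[OF A A]
    assoc_mult_mat_vec[OF A AAd] assoc_mult_mat_vec[OF A Ad] by metis

lemma Ad_Ad_A_vec: "v \<in> carrier_vec n \<Longrightarrow> Ad *\<^sub>v (Ad *\<^sub>v (A *\<^sub>v v)) = A *\<^sub>v (Ad *\<^sub>v (Ad *\<^sub>v v))"
  using arg_cong[OF Ad_Ad_A, of "\<lambda>M. M *\<^sub>v v"] assoc_mult_mat_vec[OF Ad AdA] assoc_mult_mat_vec[OF Ad A]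
    assoc_mult_mat_vec[OF A AdAd] assoc_mult_mat_vec[OF Ad Ad] by metis

text \<open>
  Since \<open>A\<close> intertwines \<open>A\<^sup>* A\<close> with \<open>A A\<^sup>*\<close>, and since \<open>A\<^sup>* A A = A A A\<^sup>*\<close>, both \<open>A\<close> and
  its adjoint exchange the eigenvalues \<open>s\<close> and \<open>r\<close>.
\<close>

lemma joint_eigenvector_A: "joint_eigenvector x s r v \<Longrightarrow> joint_eigenvector x r s (A *\<^sub>v v)"
  unfolding joint_eigenvector_def using A_carrier A_smult Ad_A_A_vec by metis

lemma joint_eigenvector_Ad: "joint_eigenvector x s r v \<Longrightarrow> joint_eigenvector x r s (Ad *\<^sub>v v)"
  unfolding joint_eigenvector_def using Ad_carrier Ad_smult Ad_A_A_vec Ad_Ad_A_vec by metis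

lemma joint_eigenvector_exists:
  assumes "n > 0"
  shows "\<exists>x s r v. joint_eigenvector x s r v \<and> v \<noteq> 0\<^sub>v n"
proof -
  let ?X = "A * A" and ?H = "Ad * A" and ?L = "A * Ad"
  note as = square_mat_simps(1)[where n = n] square_mat_simps(4)[where n = n]
  have cut: "Ad * (A * (A * M)) = A * (A * (Ad * M))" "Ad * (Ad * (A * M)) = A * (Ad * (Ad * M))"
    if "M \<in> carrier_mat n n" for M
    using arg_cong[OF Ad_A_A, of "\<lambda>Z. Z * M"] arg_cong[OF Ad_Ad_A, of "\<lambda>Z. Z * M"] A Ad that
    by (simp_all add: as)
  \<comment> \<open>Both sides become words in \<open>A\<close> and its adjoint; \<open>cut\<close> moves the adjoint past \<open>A A\<close> inside a word.\<close>
  have XH: "?X * ?H = ?H * ?X" using cut(1)[OF A] A Ad by (simp add: as)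
  have XL: "?X * ?L = ?L * ?X" using Ad_A_A A Ad by (simp add: as)
  have HL: "?H * ?L = ?L * ?H" using cut(1)[OF Ad] Ad_Ad_A A Ad by (simp add: as)
  have u: "unit_vec n 0 \<in> carrier_vec n" "unit_vec n 0 \<noteq> (0\<^sub>v n :: complex vec)"
    using assms by (auto dest: arg_cong[where f = "\<lambda>v. v $ 0"])
  obtain v1 x where v1: "v1 \<in> carrier_vec n" "v1 \<noteq> 0\<^sub>v n" "?X *\<^sub>v v1 = x \<cdot>\<^sub>v v1"
    by (rule invariant_eigenvector[OF AA u, of "\<lambda>_. True"]) auto
  obtain v2 s where v2: "v2 \<in> carrier_vec n" "v2 \<noteq> 0\<^sub>v n" "?X *\<^sub>v v2 = x \<cdot>\<^sub>v v2" "?H *\<^sub>v v2 = s \<cdot>\<^sub>v v2"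
    by (rule invariant_eigenvector[where P = "\<lambda>v. ?X *\<^sub>v v = x \<cdot>\<^sub>v v", OF AdA v1])
       (auto intro: eigenspace_invariant[OF AA AdA XH])
  have v2': "?X *\<^sub>v v2 = x \<cdot>\<^sub>v v2 \<and> ?H *\<^sub>v v2 = s \<cdot>\<^sub>v v2" using v2 by simp
  obtain v r where v: "v \<in> carrier_vec n" "v \<noteq> 0\<^sub>v n" "?X *\<^sub>v v = x \<cdot>\<^sub>v v \<and> ?H *\<^sub>v v = s \<cdot>\<^sub>v v"
      "?L *\<^sub>v v = r \<cdot>\<^sub>v v"
    by (rule invariant_eigenvector[where P = "\<lambda>v. ?X *\<^sub>v v = x \<cdot>\<^sub>v v \<and> ?H *\<^sub>v v = s \<cdot>\<^sub>v v", OF AAd v2(1,2) v2'])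
       (blast intro: eigenspace_invariant[OF AA AAd XL] eigenspace_invariant[OF AdA AAd HL])+
  have "joint_eigenvector x s r v"
    unfolding joint_eigenvector_def
    using v assoc_mult_mat_vec[OF A A v(1)] assoc_mult_mat_vec[OF A Ad v(1)] assoc_mult_mat_vec[OF Ad A v(1)]
    by simp
  then show ?thesis using v(2) by blast
qed

lemma joint_eigenvector_smult: "joint_eigenvector x s r v \<Longrightarrow> joint_eigenvector x s r (c \<cdot>\<^sub>v v)"
  unfolding joint_eigenvector_def
  by (simp add: A_smult Ad_smult A_carrier Ad_carrier smult_smult_assoc mult.commute)

lemma joint_eigenvector_values:
  assumes "joint_eigenvector x s r v"
  shows "(A *\<^sub>v v) \<bullet>c (A *\<^sub>v v) = s * (v \<bullet>c v)" "(Ad *\<^sub>v v) \<bullet>c (Ad *\<^sub>v v) = r * (v \<bullet>c v)"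
proof -
  have v: "v \<in> carrier_vec n" and "Ad *\<^sub>v (A *\<^sub>v v) = s \<cdot>\<^sub>v v" "A *\<^sub>v (Ad *\<^sub>v v) = r \<cdot>\<^sub>v v"
    using assms unfolding joint_eigenvector_def by auto
  then show "(A *\<^sub>v v) \<bullet>c (A *\<^sub>v v) = s * (v \<bullet>c v)"
    using adjoint_cscalar_prod[OF Ad A_carrier[OF v] v] by simp
  show "(Ad *\<^sub>v v) \<bullet>c (Ad *\<^sub>v v) = r * (v \<bullet>c v)"
    using adjoint_cscalar_prod[OF A Ad_carrier[OF v] v] \<open>A *\<^sub>v (Ad *\<^sub>v v) = r \<cdot>\<^sub>v v\<close> v by simp
qed

text \<open>
  \<open>A\<^sup>2\<close> is normal, so its eigenvectors are eigenvectors of its adjoint.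
\<close>

lemma joint_eigenvector_adjoint_square:
  assumes "joint_eigenvector x s r v"
  shows "Ad *\<^sub>v (Ad *\<^sub>v v) = cnj x \<cdot>\<^sub>v v"
proof -
  have v: "v \<in> carrier_vec n" and x: "A * A *\<^sub>v v = x \<cdot>\<^sub>v v"
    using assms assoc_mult_mat_vec[OF A A] unfolding joint_eigenvector_def by auto
  have "Ad * Ad *\<^sub>v (A * A *\<^sub>v v) = A * A *\<^sub>v (Ad * Ad *\<^sub>v v)"
    using normal_AA unfolding normal_mat_def adjoint_AA
    using assoc_mult_mat_vec[OF AA AdAd v] assoc_mult_mat_vec[OF AdAd AA v] by simp
  then have "Ad * Ad *\<^sub>v v = cnj x \<cdot>\<^sub>v v"
    using adjoint_eigenvector[OF AA v _ x] unfolding adjoint_AA by simp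
  then show ?thesis using assoc_mult_mat_vec[OF Ad Ad v] by simp
qed

end

lemma unit_multiple_exists:
  fixes v :: "complex vec"
  assumes v: "v \<in> carrier_vec n" "v \<noteq> 0\<^sub>v n"
  obtains c where "(c \<cdot>\<^sub>v v) \<bullet>c (c \<cdot>\<^sub>v v) = 1"
proof -
  have "v \<bullet>c v > 0" using conjugate_square_greater_0_vec[OF v(1)] v(2) by blast
  then obtain a where a: "v \<bullet>c v = complex_of_real a" "a > 0"
    by (metis less_complex_def of_real_Re complex_is_Real_iff zero_complex.sel)
  let ?c = "complex_of_real (1 / sqrt a)"
  have "(?c \<cdot>\<^sub>v v) \<bullet>c (?c \<cdot>\<^sub>v v) = ?c * (cnj ?c * (v \<bullet>c v))"
    using v cscalar_prod_smult_left[of v n "?c \<cdot>\<^sub>v v" ?c] cscalar_prod_smult_right[of v n v ?c] by simp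
  also have "\<dots> = complex_of_real (1 / sqrt a * (1 / sqrt a * a))"
    unfolding a(1) by (simp only: of_real_mult complex_cnj_complex_of_real)
  also have "1 / sqrt a * (1 / sqrt a * a) = 1" using a(2) by (simp flip: times_divide_eq_right)
  finally show thesis using that[of ?c] by (simp only: of_real_1)
qed

lemma smult_minus_vec:
  fixes v w :: "complex vec"
  assumes "v \<in> carrier_vec n" "w \<in> carrier_vec n"
  shows "c \<cdot>\<^sub>v v - c \<cdot>\<^sub>v w = c \<cdot>\<^sub>v (v - w)"
  using assms by (intro eq_vecI) (auto simp: algebra_simps)

context normal_square
begin

lemma joint_eigenvector_minus:
  assumes "joint_eigenvector x s r v" "joint_eigenvector x s r w"
  shows "joint_eigenvector x s r (v - w)"
  using assms unfolding joint_eigenvector_def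
  by (simp add: mult_minus_distrib_mat_vec[OF A] mult_minus_distrib_mat_vec[OF Ad] A_carrier Ad_carrier
      smult_minus_vec[of _ n] minus_carrier_vec)

text \<open>
  The dichotomy between the two kinds of complex blocks. If \<open>s = r\<close>, then \<open>A\<close> maps the joint
  eigenspace to itself and is normal there. If \<open>s \<noteq> r\<close>, applying the adjoint of \<open>A\<close> if
  necessary makes \<open>s\<close> the larger eigenvalue.
\<close>

lemma normal_eigenvector_or_joint_eigenvector:
  assumes "n > 0"
  shows "(\<exists>w l. w \<in> carrier_vec n \<and> w \<noteq> 0\<^sub>v n \<and> A *\<^sub>v w = l \<cdot>\<^sub>v w \<and> Ad *\<^sub>v w = cnj l \<cdot>\<^sub>v w) \<or>
    (\<exists>x s r f. joint_eigenvector x (complex_of_real s) (complex_of_real r) f \<and> f \<noteq> 0\<^sub>v n \<and> 0 \<le> r \<and> r < s)"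
proof -
  obtain x s r v where E: "joint_eigenvector x s r v" "v \<noteq> 0\<^sub>v n"
    using joint_eigenvector_exists[OF assms] by blast
  have v: "v \<in> carrier_vec n" using E unfolding joint_eigenvector_def by blast
  obtain c where "(c \<cdot>\<^sub>v v) \<bullet>c (c \<cdot>\<^sub>v v) = 1" using unit_multiple_exists[OF v E(2)] .
  moreover define u where "u = c \<cdot>\<^sub>v v"
  moreover have Eu: "joint_eigenvector x s r u" unfolding u_def by (rule joint_eigenvector_smult[OF E(1)])
  ultimately have s: "s = (A *\<^sub>v u) \<bullet>c (A *\<^sub>v u)" and r: "r = (Ad *\<^sub>v u) \<bullet>c (Ad *\<^sub>v u)"
    using joint_eigenvector_values[OF Eu] by simp_all
  have "s \<ge> 0" "r \<ge> 0" unfolding s r by blast+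
  then obtain s' r' where sr: "s = complex_of_real s'" "r = complex_of_real r'" "s' \<ge> 0" "r' \<ge> 0"
    by (metis complex_is_Real_iff less_eq_complex_def of_real_Re zero_complex.sel(1) zero_complex.sel(2) Reals_of_real)
  consider "r' < s'" | "s' < r'" | "s' = r'" by linarith
  then show ?thesis
  proof cases
    case 1
    then show ?thesis using E sr by blast
  next
    case 2
    have "(Ad *\<^sub>v v) \<bullet>c (Ad *\<^sub>v v) \<noteq> 0"
      using joint_eigenvector_values(2)[OF E(1)] 2 sr conjugate_square_eq_0_vec[OF v] E(2) by auto
    then have "Ad *\<^sub>v v \<noteq> 0\<^sub>v n" using conjugate_square_eq_0_vec[OF Ad_carrier[OF v]] by blast
    then show ?thesis using joint_eigenvector_Ad[OF E(1)] sr 2 by blast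
  next
    case 3
    then have rs: "r = s" using sr by simp
    have step: "joint_eigenvector x s s (A *\<^sub>v w - c \<cdot>\<^sub>v w)" if "joint_eigenvector x s s w" for w c
      using joint_eigenvector_minus[OF joint_eigenvector_A[OF that] joint_eigenvector_smult[OF that]] .
    obtain w l where w: "w \<in> carrier_vec n" "w \<noteq> 0\<^sub>v n" "joint_eigenvector x s s w" "A *\<^sub>v w = l \<cdot>\<^sub>v w"
      by (rule invariant_eigenvector[where P = "joint_eigenvector x s s", OF A v E(2) E(1)[unfolded rs]])
         (use step in auto)
    have "Ad *\<^sub>v w = cnj l \<cdot>\<^sub>v w"
      by (rule adjoint_eigenvector[OF A w(1) _ w(4)]) (use w(3) in \<open>simp add: joint_eigenvector_def\<close>)
    then show ?thesis using w by blast
  qed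
qed

text \<open>
  The plane spanned by \<open>f\<close> and \<open>e = A f / \<surd>s\<close> carries the block with parameters \<open>t = \<surd>s\<close> and
  \<open>\<nu> = x / s\<close>. The two vectors are orthogonal as eigenvectors of \<open>A\<^sup>* A\<close> for the distinct
  eigenvalues \<open>r\<close> and \<open>s\<close>, and \<open>\<bar>\<nu>\<bar> < 1\<close> because \<open>\<bar>x\<bar>\<^sup>2 = \<parallel>A A f\<parallel>\<^sup>2 = r s\<close>.
\<close>

lemma joint_eigenvector_pair:
  assumes E: "joint_eigenvector x (complex_of_real s) (complex_of_real r) f" and unit: "f \<bullet>c f = 1"
    and sr: "0 \<le> r" "r < s"
  defines "t \<equiv> complex_of_real (sqrt s)" and "\<nu> \<equiv> x / complex_of_real s"
  defines "e \<equiv> (1 / t) \<cdot>\<^sub>v (A *\<^sub>v f)"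
  shows "joint_eigenvector x (complex_of_real r) (complex_of_real s) e"
    and "e \<bullet>c e = 1" "e \<bullet>c f = 0" "cmod \<nu> < 1"
    and "A *\<^sub>v f = t \<cdot>\<^sub>v e" "A *\<^sub>v e = (t * \<nu>) \<cdot>\<^sub>v f"
    and "Ad *\<^sub>v e = t \<cdot>\<^sub>v f" "Ad *\<^sub>v f = (t * cnj \<nu>) \<cdot>\<^sub>v e"
proof -
  have f: "f \<in> carrier_vec n" and AAf: "A *\<^sub>v (A *\<^sub>v f) = x \<cdot>\<^sub>v f"
    and AdAf: "Ad *\<^sub>v (A *\<^sub>v f) = complex_of_real s \<cdot>\<^sub>v f"
    using E unfolding joint_eigenvector_def by auto
  note Af = A_carrier[OF f]
  have t: "t \<noteq> 0" "t * t = complex_of_real s" "cnj t = t"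
    using sr unfolding t_def by (simp_all flip: of_real_mult)
  have s: "complex_of_real s \<noteq> 0" using sr by simp
  note EA = joint_eigenvector_A[OF E]
  show Ee: "joint_eigenvector x (complex_of_real r) (complex_of_real s) e"
    unfolding e_def by (rule joint_eigenvector_smult[OF EA])
  have e: "e \<in> carrier_vec n" using Ee unfolding joint_eigenvector_def by blast
  have norm: "(A *\<^sub>v f) \<bullet>c (A *\<^sub>v f) = complex_of_real s"
    using joint_eigenvector_values(1)[OF E] unit by simp
  show "e \<bullet>c e = 1"
    unfolding e_def
    using cscalar_prod_smult_left[of "A *\<^sub>v f" n "(1 / t) \<cdot>\<^sub>v (A *\<^sub>v f)" "1 / t"]
      cscalar_prod_smult_right[OF Af Af, of "1 / t"] Af norm t s by simp
  show Af_e: "A *\<^sub>v f = t \<cdot>\<^sub>v e" unfolding e_def using t by (simp add: smult_smult_assoc)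
  show "A *\<^sub>v e = (t * \<nu>) \<cdot>\<^sub>v f"
    unfolding e_def A_smult[OF Af] AAf smult_smult_assoc \<nu>_def t(2)[symmetric] using t(1) by simp
  show "Ad *\<^sub>v e = t \<cdot>\<^sub>v f"
    unfolding e_def Ad_smult[OF Af] AdAf smult_smult_assoc t(2)[symmetric] using t(1) by simp
  have "complex_of_real s \<cdot>\<^sub>v (Ad *\<^sub>v f) = Ad *\<^sub>v (Ad *\<^sub>v (A *\<^sub>v f))"
    unfolding AdAf using Ad_smult[OF f] by simp
  also have "\<dots> = cnj x \<cdot>\<^sub>v (A *\<^sub>v f)"
    unfolding Ad_Ad_A_vec[OF f] joint_eigenvector_adjoint_square[OF E] by (rule A_smult[OF f])
  finally have "(1 / complex_of_real s) \<cdot>\<^sub>v (complex_of_real s \<cdot>\<^sub>v (Ad *\<^sub>v f)) =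
      (1 / complex_of_real s) \<cdot>\<^sub>v (cnj x \<cdot>\<^sub>v (t \<cdot>\<^sub>v e))"
    unfolding Af_e by simp
  then show "Ad *\<^sub>v f = (t * cnj \<nu>) \<cdot>\<^sub>v e"
    unfolding smult_smult_assoc \<nu>_def using s by (simp add: mult.commute)
  have "x * cnj x = complex_of_real r * complex_of_real s"
    using joint_eigenvector_values(1)[OF EA] norm unfolding AAf
    using cscalar_prod_smult_left[of f n "x \<cdot>\<^sub>v f" x] cscalar_prod_smult_right[OF f f, of x] f unit by simp
  then have "(cmod x)\<^sup>2 = r * s"
    by (metis complex_norm_square of_real_eq_iff of_real_mult)
  also have "\<dots> < s\<^sup>2" using sr by (simp add: power2_eq_square)
  finally have "cmod x < s" using sr by (simp add: power2_less_imp_less)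
  then show "cmod \<nu> < 1" unfolding \<nu>_def using sr by (simp add: norm_divide)
  have "Ad *\<^sub>v (A *\<^sub>v e) = complex_of_real r \<cdot>\<^sub>v e" using Ee unfolding joint_eigenvector_def by blast
  then have "complex_of_real r * (e \<bullet>c f) = (Ad *\<^sub>v (A *\<^sub>v e)) \<bullet>c f"
    using cscalar_prod_smult_left[OF e f] by simp
  also have "\<dots> = e \<bullet>c (Ad *\<^sub>v (A *\<^sub>v f))"
    using adjoint_cscalar_prod[OF Ad A_carrier[OF e] f] adjoint_cscalar_prod[OF A e Af] by simp
  also have "\<dots> = complex_of_real s * (e \<bullet>c f)"
    unfolding AdAf using cscalar_prod_smult_right[OF e f] by simp
  finally show "e \<bullet>c f = 0" using sr by simp
qed

end

section \<open>Real and imaginary parts of eigenvectors\<close>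

abbreviation re_vec :: "complex vec \<Rightarrow> real vec" where
  "re_vec \<equiv> map_vec Re"

abbreviation im_vec :: "complex vec \<Rightarrow> real vec" where
  "im_vec \<equiv> map_vec Im"

lemma complexify_mult_vec_re_im:
  assumes "R \<in> carrier_mat n n" "v \<in> carrier_vec n"
  shows "R *\<^sub>v re_vec v = re_vec (complexify R *\<^sub>v v)" "R *\<^sub>v im_vec v = im_vec (complexify R *\<^sub>v v)"
  using assms by (auto intro!: eq_vecI simp: scalar_prod_def)

lemma complexify_mult_vec_conjugate:
  assumes "R \<in> carrier_mat n n" "v \<in> carrier_vec n"
  shows "complexify R *\<^sub>v conjugate v = conjugate (complexify R *\<^sub>v v)"
  using assms by (auto intro!: eq_vecI simp: scalar_prod_def)

lemma scalar_prod_re_im: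
  assumes "v \<in> carrier_vec n" "w \<in> carrier_vec n"
  shows "Re (v \<bullet> w) = re_vec v \<bullet> re_vec w - im_vec v \<bullet> im_vec w"
    "Im (v \<bullet> w) = re_vec v \<bullet> im_vec w + im_vec v \<bullet> re_vec w"
    "Re (v \<bullet>c w) = re_vec v \<bullet> re_vec w + im_vec v \<bullet> im_vec w"
    "Im (v \<bullet>c w) = im_vec v \<bullet> re_vec w - re_vec v \<bullet> im_vec w"
  using assms by (simp_all add: scalar_prod_def sum_subtractf sum.distrib)

text \<open>
  For a real matrix the conjugate of \<open>w\<close> is an adjoint eigenvector for \<open>l\<close> instead of \<open>cnj l\<close>. For
  nonreal \<open>l\<close> it is therefore orthogonal to \<open>v\<close>, and this is the bilinear product of \<open>v\<close> and \<open>w\<close>.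
  With \<open>v = w\<close> it makes the real and imaginary parts of \<open>v\<close> orthogonal and of equal length.
\<close>

lemma bilinear_eigenvectors_orthogonal:
  assumes R: "R \<in> carrier_mat n n" and v: "v \<in> carrier_vec n" and w: "w \<in> carrier_vec n"
    and "complexify R *\<^sub>v v = l \<cdot>\<^sub>v v" "mat_adjoint (complexify R) *\<^sub>v w = cnj l \<cdot>\<^sub>v w" "Im l \<noteq> 0"
  shows "v \<bullet> w = 0"
proof -
  have cw: "conjugate w \<in> carrier_vec n" using w by simp
  have T: "transpose_mat R \<in> carrier_mat n n" and C: "complexify R \<in> carrier_mat n n" using R by auto
  have "l * (v \<bullet>c conjugate w) = (complexify R *\<^sub>v v) \<bullet>c conjugate w"
    unfolding assms(4) using cscalar_prod_smult_left[OF v cw] by simp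
  also have "\<dots> = v \<bullet>c (mat_adjoint (complexify R) *\<^sub>v conjugate w)"
    by (rule adjoint_cscalar_prod[OF C v cw])
  also have "mat_adjoint (complexify R) *\<^sub>v conjugate w = l \<cdot>\<^sub>v conjugate w"
    unfolding adjoint_complexify complexify_mult_vec_conjugate[OF T w]
    using assms(5) unfolding adjoint_complexify by (simp add: conjugate_smult_vec)
  also have "v \<bullet>c (l \<cdot>\<^sub>v conjugate w) = cnj l * (v \<bullet>c conjugate w)"
    by (rule cscalar_prod_smult_right[OF v cw])
  finally have "(l - cnj l) * (v \<bullet> w) = 0" by (simp add: algebra_simps)
  moreover have "l - cnj l \<noteq> 0" using assms(6) by (auto simp: complex_eq_iff)
  ultimately show ?thesis by simp
qed

section \<open>Splitting off a reducing subspace\<close>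

definition orthonormal_family :: "nat \<Rightarrow> nat \<Rightarrow> (nat \<Rightarrow> real vec) \<Rightarrow> bool" where
  "orthonormal_family n k q \<longleftrightarrow> (\<forall>i<k. q i \<in> carrier_vec n) \<and>
    (\<forall>i<k. \<forall>j<k. q i \<bullet> q j = (if i = j then 1 else 0))"

lemma orthogonal_vector_exists:
  fixes q :: "nat \<Rightarrow> 'a :: field vec"
  assumes q: "\<And>i. i < k \<Longrightarrow> q i \<in> carrier_vec n" and "k < n"
  obtains x where "x \<in> carrier_vec n" "x \<noteq> 0\<^sub>v n" "\<And>i. i < k \<Longrightarrow> q i \<bullet> x = 0"
proof -
  let ?c = "\<lambda>i. if i < k then q i else 0\<^sub>v n"
  \<comment> \<open>Rows beyond the given vectors are zero; the zero row number \<open>k\<close> makes the square matrix singular.\<close>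
  let ?W = "mat\<^sub>r n n (\<lambda>i. if i = k then 0\<^sub>v n else ?c i)"
  have "det ?W = 0" using q by (intro det_row_0[OF \<open>k < n\<close>]) auto
  moreover have W: "?W \<in> carrier_mat n n" by simp
  ultimately obtain x where x: "x \<in> carrier_vec n" "x \<noteq> 0\<^sub>v n" "?W *\<^sub>v x = 0\<^sub>v n"
    using det_0_iff_vec_prod_zero_field[OF W] by blast
  have "q i \<bullet> x = 0" if "i < k" for i
  proof -
    have "row ?W i = q i" using that \<open>k < n\<close> q[OF that] by (intro eq_vecI) auto
    moreover have "(?W *\<^sub>v x) $ i = row ?W i \<bullet> x" using that \<open>k < n\<close> by (intro index_mult_mat_vec) auto
    ultimately show ?thesis using x(3) that \<open>k < n\<close> by simp
  qed
  then show thesis using that x by blast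
qed

lemma orthonormal_family_extend:
  assumes "orthonormal_family n k q" "k \<le> n"
  shows "\<exists>p. orthonormal_family n n p \<and> (\<forall>i<k. p i = q i)"
  using assms
proof (induction "n - k" arbitrary: k q)
  case 0
  then show ?case by auto
next
  case (Suc d)
  note q = Suc.prems(1)[unfolded orthonormal_family_def]
  have "k < n" using Suc by simp
  then obtain x where x: "x \<in> carrier_vec n" "x \<noteq> 0\<^sub>v n" "\<And>i. i < k \<Longrightarrow> q i \<bullet> x = 0"
    using orthogonal_vector_exists[of k q n] q by blast
  have pos: "x \<bullet> x > 0" using conjugate_square_greater_0_vec[OF x(1)] x(2) by simp
  define u where "u = (1 / sqrt (x \<bullet> x)) \<cdot>\<^sub>v x"
  have u: "u \<in> carrier_vec n" unfolding u_def using x by simp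
  have uu: "u \<bullet> u = 1" unfolding u_def using x(1) pos by simp
  have qu: "q i \<bullet> u = 0" "u \<bullet> q i = 0" if "i < k" for i
    using x(1) x(3)[OF that] that q comm_scalar_prod[OF u, of "q i"] unfolding u_def by simp_all
  let ?q = "q(k := u)"
  have "orthonormal_family n (Suc k) ?q"
    unfolding orthonormal_family_def using q u uu qu by (auto simp: less_Suc_eq)
  then obtain p where "orthonormal_family n n p" "\<forall>i<Suc k. p i = ?q i"
    using Suc.hyps(1)[of "Suc k" ?q] Suc.hyps(2) \<open>k < n\<close> by (metis Suc_leI diff_Suc_eq_diff_pred diff_Suc_1 diff_commute Suc_diff_Suc nat.inject)
  then show ?case by (metis fun_upd_other less_Suc_eq less_irrefl)
qed

lemma orthonormal_family_matrix:
  assumes "orthonormal_family n n p"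
  defines "R \<equiv> mat_of_cols n (map p [0..<n])"
  shows "R \<in> carrier_mat n n" "transpose_mat R * R = 1\<^sub>m n" "\<And>i. i < n \<Longrightarrow> col R i = p i"
proof -
  show R: "R \<in> carrier_mat n n" unfolding R_def by (simp add: carrier_matI)
  show c: "col R i = p i" if "i < n" for i
    unfolding R_def using that assms(1) by (subst col_mat_of_cols) (auto simp: orthonormal_family_def)
  show "transpose_mat R * R = 1\<^sub>m n"
    using R assms(1) by (intro eq_matI) (auto simp: c orthonormal_family_def)
qed

text \<open>
  If there were more than \<open>n\<close> vectors, the first \<open>n\<close> would form an orthogonal matrix, whose
  transpose annihilates the next vector.
\<close>

lemma orthonormal_family_size:
  assumes q: "orthonormal_family n k q"
  shows "k \<le> n"
proof (rule ccontr)
  assume "\<not> k \<le> n"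
  then have "orthonormal_family n n q" using q unfolding orthonormal_family_def by auto
  note R = orthonormal_family_matrix[OF this]
  let ?R = "mat_of_cols n (map q [0..<n])"
  have T: "transpose_mat ?R \<in> carrier_mat n n" using R(1) by simp
  have qn: "q n \<in> carrier_vec n" "q n \<bullet> q n = 1" using q \<open>\<not> k \<le> n\<close> unfolding orthonormal_family_def by auto
  have "transpose_mat ?R *\<^sub>v q n = 0\<^sub>v n"
  proof (rule eq_vecI)
    fix i assume "i < dim_vec (0\<^sub>v n :: real vec)"
    then have i: "i < n" by simp
    then have "(transpose_mat ?R *\<^sub>v q n) $ i = q i \<bullet> q n"
      using R(1) R(3)[OF i] by (subst index_mult_mat_vec) auto
    then show "(transpose_mat ?R *\<^sub>v q n) $ i = 0\<^sub>v n $ i"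
      using q i \<open>\<not> k \<le> n\<close> unfolding orthonormal_family_def by auto
  qed simp
  then have "(?R * transpose_mat ?R) *\<^sub>v q n = 0\<^sub>v n"
    using assoc_mult_mat_vec[OF R(1) T qn(1)] R(1) by (auto intro!: eq_vecI)
  then have "q n = 0\<^sub>v n" using mat_mult_left_right_inverse[OF T R(1,2)] qn(1) by simp
  then show False using qn by simp
qed

text \<open>
  The span of the orthonormal vectors \<open>q i\<close> is invariant under \<open>A\<close> and its transpose, and \<open>A\<close> acts
  on it with matrix \<open>B\<close>. Invariance is expressed by the vanishing of scalar products with the
  orthogonal complement, which is the form in which the off-diagonal blocks appear.
\<close>

definition reduces_on :: "real mat \<Rightarrow> nat \<Rightarrow> nat \<Rightarrow> (nat \<Rightarrow> real vec) \<Rightarrow> real mat \<Rightarrow> bool" where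
  "reduces_on A n k q B \<longleftrightarrow> orthonormal_family n k q \<and> B \<in> carrier_mat k k \<and>
    (\<forall>i<k. \<forall>j<k. q i \<bullet> (A *\<^sub>v q j) = B $$ (i, j)) \<and>
    (\<forall>u\<in>carrier_vec n. (\<forall>i<k. u \<bullet> q i = 0) \<longrightarrow>
      (\<forall>j<k. u \<bullet> (A *\<^sub>v q j) = 0 \<and> u \<bullet> (transpose_mat A *\<^sub>v q j) = 0))"

lemma reducing_subspace_splits:
  assumes A: "A \<in> carrier_mat n n" and red: "reduces_on A n k q B"
  obtains D where "D \<in> carrier_mat (n - k) (n - k)" "k \<le> n"
    "orthogonally_similar A (four_block_mat B (0\<^sub>m k (n - k)) (0\<^sub>m (n - k) k) D)"
proof -
  have q: "orthonormal_family n k q" and B: "B \<in> carrier_mat k k"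
    and qAq: "\<And>i j. i < k \<Longrightarrow> j < k \<Longrightarrow> q i \<bullet> (A *\<^sub>v q j) = B $$ (i, j)"
    and inv: "\<And>u j. u \<in> carrier_vec n \<Longrightarrow> \<forall>i<k. u \<bullet> q i = 0 \<Longrightarrow> j < k \<Longrightarrow>
      u \<bullet> (A *\<^sub>v q j) = 0 \<and> u \<bullet> (transpose_mat A *\<^sub>v q j) = 0"
    using red unfolding reduces_on_def by auto
  have kn: "k \<le> n" by (rule orthonormal_family_size[OF q])
  obtain p where p: "orthonormal_family n n p" and pq: "\<And>i. i < k \<Longrightarrow> p i = q i"
    using orthonormal_family_extend[OF q kn] by blast
  define R where "R = mat_of_cols n (map p [0..<n])"
  note R = orthonormal_family_matrix[OF p, folded R_def]
  have pc: "p i \<in> carrier_vec n" if "i < n" for i using p that unfolding orthonormal_family_def by blast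
  have orth: "\<forall>i<k. p j \<bullet> q i = 0" if "k \<le> j" "j < n" for j
  proof (intro allI impI)
    fix i assume "i < k"
    then have "i < n" "i \<noteq> j" using kn that by auto
    then have "p j \<bullet> p i = 0" using p that(2) unfolding orthonormal_family_def by metis
    then show "p j \<bullet> q i = 0" using pq[OF \<open>i < k\<close>] by simp
  qed
  have entry: "(transpose_mat R * A * R) $$ (i, j) = p i \<bullet> (A *\<^sub>v p j)" if "i < n" "j < n" for i j
  proof -
    have "(transpose_mat R * (A * R)) $$ (i, j) = col R i \<bullet> col (A * R) j" using R(1) A that by simp
    also have "col (A * R) j = A *\<^sub>v col R j" using R(1) A that by (intro eq_vecI) auto
    finally have "(transpose_mat R * (A * R)) $$ (i, j) = col R i \<bullet> (A *\<^sub>v col R j)" .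
    then show ?thesis using R A that by (simp add: assoc_mult_mat[of _ n n _ n _ n])
  qed
  define D where "D = mat (n - k) (n - k) (\<lambda>(i, j). p (i + k) \<bullet> (A *\<^sub>v p (j + k)))"
  have "transpose_mat R * A * R = four_block_mat B (0\<^sub>m k (n - k)) (0\<^sub>m (n - k) k) D" (is "_ = ?F")
  proof (rule eq_matI)
    have dim: "dim_row ?F = n" "dim_col ?F = n" using B kn unfolding D_def by auto
    show "dim_row (transpose_mat R * A * R) = dim_row ?F" "dim_col (transpose_mat R * A * R) = dim_col ?F"
      using dim R(1) by auto
    fix i j assume "i < dim_row ?F" "j < dim_col ?F"
    then have ij: "i < n" "j < n" using dim by auto
    have F: "?F $$ (i, j) = (if i < k then if j < k then B $$ (i, j) else 0
        else if j < k then 0 else p i \<bullet> (A *\<^sub>v p j))"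
      using ij B kn unfolding D_def by (simp add: Let_def)
    have "p i \<bullet> (A *\<^sub>v p j) = 0" if "i < k" "\<not> j < k"
    proof -
      have "p i \<bullet> (A *\<^sub>v p j) = (transpose_mat A *\<^sub>v p i) \<bullet> p j"
        by (rule transpose_vec_mult_scalar[OF A pc[OF ij(2)] pc[OF ij(1)], symmetric])
      also have "\<dots> = p j \<bullet> (transpose_mat A *\<^sub>v q i)"
        unfolding pq[OF that(1)] using A pc[OF ij(2)] pc[OF ij(1)] pq[OF that(1)]
        by (intro comm_scalar_prod[of _ n]) auto
      also have "\<dots> = 0" using inv[OF pc[OF ij(2)] orth that(1)] that(2) ij by simp
      finally show ?thesis .
    qed
    moreover have "p i \<bullet> (A *\<^sub>v p j) = 0" if "\<not> i < k" "j < k"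
      using inv[OF pc[OF ij(1)] orth that(2)] that ij pq by simp
    ultimately show "(transpose_mat R * A * R) $$ (i, j) = ?F $$ (i, j)"
      unfolding entry[OF ij] F using qAq pq by auto
  qed
  then show thesis
    using that[of D] kn orthogonally_similarI[OF A R(1,2)] unfolding D_def by auto
qed

section \<open>Existence of the real canonical form\<close>

lemma all_less_1_2_4:
  "(\<forall>i<(1::nat). P i) \<longleftrightarrow> P 0"
  "(\<forall>i<(2::nat). P i) \<longleftrightarrow> P 0 \<and> P 1"
  "(\<forall>i<(4::nat). P i) \<longleftrightarrow> P 0 \<and> P 1 \<and> P 2 \<and> P 3"
proof -
  show "(\<forall>i<(1::nat). P i) \<longleftrightarrow> P 0" by auto
  show "(\<forall>i<(2::nat). P i) \<longleftrightarrow> P 0 \<and> P 1" by (auto simp: less_2_cases_iff)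
  have "i < 4 \<longleftrightarrow> i = 0 \<or> i = 1 \<or> i = 2 \<or> i = 3" for i :: nat by linarith
  then show "(\<forall>i<(4::nat). P i) \<longleftrightarrow> P 0 \<and> P 1 \<and> P 2 \<and> P 3" by auto
qed

lemma real_blocksI:
  "block1 l \<in> real_blocks"
  "t > 0 \<Longrightarrow> \<bar>\<nu>\<bar> < 1 \<Longrightarrow> block2 t \<nu> \<in> real_blocks"
  "b > 0 \<Longrightarrow> rot_block a b \<in> real_blocks"
  "t > 0 \<Longrightarrow> d > 0 \<Longrightarrow> c\<^sup>2 + d\<^sup>2 < 1 \<Longrightarrow> block4 t c d \<in> real_blocks"
  unfolding real_blocks_def by blast+

lemma reduces_on_block1:
  assumes "u \<in> carrier_vec n" "u \<bullet> u = 1" "A *\<^sub>v u = a \<cdot>\<^sub>v u" "transpose_mat A *\<^sub>v u = a \<cdot>\<^sub>v u"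
  shows "reduces_on A n 1 (\<lambda>_. u) (block1 a)"
  unfolding reduces_on_def orthonormal_family_def all_less_1_2_4
  using assms by (simp del: One_nat_def)

lemma reduces_on_rot_block:
  assumes "x \<in> carrier_vec n" "y \<in> carrier_vec n" "x \<bullet> x = 1" "y \<bullet> y = 1" "x \<bullet> y = 0"
    and "A *\<^sub>v x = a \<cdot>\<^sub>v x + b \<cdot>\<^sub>v y" "A *\<^sub>v y = (- b) \<cdot>\<^sub>v x + a \<cdot>\<^sub>v y"
    and "transpose_mat A *\<^sub>v x = a \<cdot>\<^sub>v x + (- b) \<cdot>\<^sub>v y" "transpose_mat A *\<^sub>v y = b \<cdot>\<^sub>v x + a \<cdot>\<^sub>v y"
  shows "reduces_on A n 2 (\<lambda>i. [x, y] ! i) (rot_block a b)"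
proof -
  have "y \<bullet> x = 0" using assms comm_scalar_prod[of x n y] by simp
  then show ?thesis
    unfolding reduces_on_def orthonormal_family_def all_less_1_2_4
    using assms by (simp add: scalar_prod_add_distrib[of _ n])
qed

lemma reduces_on_block2:
  assumes "x \<in> carrier_vec n" "y \<in> carrier_vec n" "x \<bullet> x = 1" "y \<bullet> y = 1" "x \<bullet> y = 0"
    and "A *\<^sub>v x = (t * \<nu>) \<cdot>\<^sub>v y" "A *\<^sub>v y = t \<cdot>\<^sub>v x"
    and "transpose_mat A *\<^sub>v x = t \<cdot>\<^sub>v y" "transpose_mat A *\<^sub>v y = (t * \<nu>) \<cdot>\<^sub>v x"
  shows "reduces_on A n 2 (\<lambda>i. [x, y] ! i) (block2 t \<nu>)"
proof -
  have "y \<bullet> x = 0" using assms comm_scalar_prod[of x n y] by simp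
  then show ?thesis
    unfolding reduces_on_def orthonormal_family_def all_less_1_2_4
    using assms by simp
qed

lemma reduces_on_block4:
  assumes c: "x0 \<in> carrier_vec n" "x1 \<in> carrier_vec n" "x2 \<in> carrier_vec n" "x3 \<in> carrier_vec n"
    and "x0 \<bullet> x0 = 1" "x1 \<bullet> x1 = 1" "x2 \<bullet> x2 = 1" "x3 \<bullet> x3 = 1"
    and o: "x0 \<bullet> x1 = 0" "x0 \<bullet> x2 = 0" "x0 \<bullet> x3 = 0" "x1 \<bullet> x2 = 0" "x1 \<bullet> x3 = 0" "x2 \<bullet> x3 = 0"
    and "A *\<^sub>v x0 = (t * c) \<cdot>\<^sub>v x2 + (t * d) \<cdot>\<^sub>v x3" "A *\<^sub>v x1 = (- (t * d)) \<cdot>\<^sub>v x2 + (t * c) \<cdot>\<^sub>v x3"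
    and "A *\<^sub>v x2 = t \<cdot>\<^sub>v x0" "A *\<^sub>v x3 = t \<cdot>\<^sub>v x1"
    and "transpose_mat A *\<^sub>v x0 = t \<cdot>\<^sub>v x2" "transpose_mat A *\<^sub>v x1 = t \<cdot>\<^sub>v x3"
    and "transpose_mat A *\<^sub>v x2 = (t * c) \<cdot>\<^sub>v x0 + (- (t * d)) \<cdot>\<^sub>v x1"
    and "transpose_mat A *\<^sub>v x3 = (t * d) \<cdot>\<^sub>v x0 + (t * c) \<cdot>\<^sub>v x1"
  shows "reduces_on A n 4 (\<lambda>i. [x0, x1, x2, x3] ! i) (block4 t c d)"
proof -
  have "x1 \<bullet> x0 = 0" "x2 \<bullet> x0 = 0" "x3 \<bullet> x0 = 0" "x2 \<bullet> x1 = 0" "x3 \<bullet> x1 = 0" "x3 \<bullet> x2 = 0"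
    using o comm_scalar_prod[OF c(2,1)] comm_scalar_prod[OF c(3,1)] comm_scalar_prod[OF c(4,1)]
      comm_scalar_prod[OF c(3,2)] comm_scalar_prod[OF c(4,2)] comm_scalar_prod[OF c(4,3)] by simp_all
  then show ?thesis
    unfolding reduces_on_def orthonormal_family_def all_less_1_2_4
    using assms by (simp add: scalar_prod_add_distrib[of _ n] index_block4)
qed

lemma re_im_vec_zero:
  assumes "v \<in> carrier_vec n" "re_vec v = 0\<^sub>v n" "im_vec v = 0\<^sub>v n"
  shows "v = 0\<^sub>v n"
proof (rule eq_vecI)
  fix i assume "i < dim_vec (0\<^sub>v n :: complex vec)"
  then have i: "i < n" by simp
  have "re_vec v $ i = 0" "im_vec v $ i = 0" using assms(2,3) i by simp_all
  then show "v $ i = 0\<^sub>v n $ i" using i assms(1) by (simp add: complex_eq_iff)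
qed (use assms in auto)

lemma unit_multiple_exists_real:
  fixes u :: "real vec"
  assumes u: "u \<in> carrier_vec n" "u \<noteq> 0\<^sub>v n"
  obtains c where "(c \<cdot>\<^sub>v u) \<bullet> (c \<cdot>\<^sub>v u) = 1"
proof -
  have "u \<bullet> u > 0" using conjugate_square_greater_0_vec[OF u(1)] u(2) by simp
  then have "((1 / sqrt (u \<bullet> u)) \<cdot>\<^sub>v u) \<bullet> ((1 / sqrt (u \<bullet> u)) \<cdot>\<^sub>v u) = 1" using u(1) by simp
  then show thesis by (rule that)
qed

text \<open>
  The squared length is \<open>2\<close>, so that the real and imaginary parts come out as unit vectors.
\<close>

lemma isotropic_vector_re_im:
  assumes "v \<in> carrier_vec n" "v \<bullet>c v = 2" "v \<bullet> v = 0"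
  shows "re_vec v \<bullet> re_vec v = 1" "im_vec v \<bullet> im_vec v = 1" "re_vec v \<bullet> im_vec v = 0"
proof -
  have "im_vec v \<bullet> re_vec v = re_vec v \<bullet> im_vec v"
    using assms(1) by (intro comm_scalar_prod[of _ n]) auto
  then show "re_vec v \<bullet> re_vec v = 1" "im_vec v \<bullet> im_vec v = 1" "re_vec v \<bullet> im_vec v = 0"
    using scalar_prod_re_im[OF assms(1,1)] assms(2,3) by simp_all
qed

lemma isotropic_pair_re_im:
  assumes "v \<in> carrier_vec n" "w \<in> carrier_vec n" "v \<bullet>c w = 0" "v \<bullet> w = 0"
  shows "re_vec v \<bullet> re_vec w = 0" "im_vec v \<bullet> im_vec w = 0" "re_vec v \<bullet> im_vec w = 0" "im_vec v \<bullet> re_vec w = 0"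
  using scalar_prod_re_im[OF assms(1,2)] assms(3,4) by simp_all

text \<open>
  In the basis formed by the real part and the negative imaginary part, multiplication by
  \<open>a + b \<i>\<close> has the matrix \<open>[[a, -b], [b, a]]\<close>; the sign of the imaginary part is chosen to match
  the shape of the real blocks.
\<close>

lemma re_neg_im_smult:
  assumes "v \<in> carrier_vec n"
  shows "re_vec (c \<cdot>\<^sub>v v) = Re c \<cdot>\<^sub>v re_vec v + Im c \<cdot>\<^sub>v (- im_vec v)"
    "- im_vec (c \<cdot>\<^sub>v v) = (- Im c) \<cdot>\<^sub>v re_vec v + Re c \<cdot>\<^sub>v (- im_vec v)"
  using assms by (auto intro!: eq_vecI)

lemma complexify_mult_vec_neg_im:
  assumes "R \<in> carrier_mat n n" "v \<in> carrier_vec n"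
  shows "R *\<^sub>v (- im_vec v) = - im_vec (complexify R *\<^sub>v v)"
  using assms by (auto intro!: eq_vecI simp: scalar_prod_def sum_negf)

text \<open>
  A real eigenvalue leaves a real eigenvector, since the real and imaginary parts are eigenvectors
  too. For a nonreal eigenvalue, conjugation arranges a positive imaginary part, and the real and
  negative imaginary parts span a plane on which the matrix is a scaled rotation.
\<close>

lemma reducing_block_of_normal_eigenvector:
  assumes R: "R \<in> carrier_mat n n" and w: "w \<in> carrier_vec n" "w \<noteq> 0\<^sub>v n"
    and eig: "complexify R *\<^sub>v w = l \<cdot>\<^sub>v w" "mat_adjoint (complexify R) *\<^sub>v w = cnj l \<cdot>\<^sub>v w"
  shows "\<exists>k q B. k > 0 \<and> B \<in> real_blocks \<and> reduces_on R n k q B"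
proof -
  have T: "transpose_mat R \<in> carrier_mat n n" and C: "complexify R \<in> carrier_mat n n"
    and Cd: "complexify (transpose_mat R) \<in> carrier_mat n n" using R by auto
  note eig' = eig(2)[unfolded adjoint_complexify]
  show ?thesis
  proof (cases "Im l = 0")
    case True
    have re: "R *\<^sub>v re_vec w = Re l \<cdot>\<^sub>v re_vec w" "transpose_mat R *\<^sub>v re_vec w = Re l \<cdot>\<^sub>v re_vec w"
      "R *\<^sub>v im_vec w = Re l \<cdot>\<^sub>v im_vec w" "transpose_mat R *\<^sub>v im_vec w = Re l \<cdot>\<^sub>v im_vec w"
      unfolding complexify_mult_vec_re_im[OF R w(1)] complexify_mult_vec_re_im[OF T w(1)] eig eig'
      using w(1) True by (auto intro!: eq_vecI)
    have "\<exists>u. u \<in> carrier_vec n \<and> u \<noteq> 0\<^sub>v n \<and> R *\<^sub>v u = Re l \<cdot>\<^sub>v u \<and> transpose_mat R *\<^sub>v u = Re l \<cdot>\<^sub>v u"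
      using re re_im_vec_zero[OF w(1)] w by (metis map_carrier_vec)
    then obtain u where u: "u \<in> carrier_vec n" "u \<noteq> 0\<^sub>v n"
      "R *\<^sub>v u = Re l \<cdot>\<^sub>v u" "transpose_mat R *\<^sub>v u = Re l \<cdot>\<^sub>v u" by blast
    obtain c where c: "(c \<cdot>\<^sub>v u) \<bullet> (c \<cdot>\<^sub>v u) = 1" using unit_multiple_exists_real[OF u(1,2)] .
    have "reduces_on R n 1 (\<lambda>_. c \<cdot>\<^sub>v u) (block1 (Re l))"
      by (rule reduces_on_block1[OF _ c])
         (use u in \<open>simp_all add: mult_mat_vec[OF R] mult_mat_vec[OF T] smult_smult_assoc mult.commute\<close>)
    then show ?thesis using real_blocksI(1) by (metis less_Suc_eq_0_disj One_nat_def)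
  next
    case False
    obtain w' l' where w': "w' \<in> carrier_vec n" "w' \<noteq> 0\<^sub>v n" "Im l' > 0"
      "complexify R *\<^sub>v w' = l' \<cdot>\<^sub>v w'" "complexify (transpose_mat R) *\<^sub>v w' = cnj l' \<cdot>\<^sub>v w'"
    proof (cases "Im l > 0")
      case True
      then show ?thesis using that[of w l] w eig eig' by blast
    next
      case neg: False
      show ?thesis
      proof (rule that[of "conjugate w" "cnj l"])
        show "complexify R *\<^sub>v conjugate w = cnj l \<cdot>\<^sub>v conjugate w"
          unfolding complexify_mult_vec_conjugate[OF R w(1)] eig by (simp add: conjugate_smult_vec)
        show "complexify (transpose_mat R) *\<^sub>v conjugate w = cnj (cnj l) \<cdot>\<^sub>v conjugate w"
          unfolding complexify_mult_vec_conjugate[OF T w(1)] eig' by (simp add: conjugate_smult_vec)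
      qed (use w neg False in auto)
    qed
    obtain c where c: "(c \<cdot>\<^sub>v w') \<bullet>c (c \<cdot>\<^sub>v w') = 1" using unit_multiple_exists[OF w'(1,2)] .
    define v where "v = complex_of_real (sqrt 2) \<cdot>\<^sub>v (c \<cdot>\<^sub>v w')"
    have cw: "c \<cdot>\<^sub>v w' \<in> carrier_vec n" using w' by simp
    have v: "v \<in> carrier_vec n" unfolding v_def using w' by simp
    have vv: "v \<bullet>c v = 2"
      unfolding v_def using cscalar_prod_smult_left[OF cw, of "complex_of_real (sqrt 2) \<cdot>\<^sub>v (c \<cdot>\<^sub>v w')" "complex_of_real (sqrt 2)"]
        cscalar_prod_smult_right[OF cw cw, of "complex_of_real (sqrt 2)"] c cw
      by (simp flip: of_real_mult)
    have eigv: "complexify R *\<^sub>v v = l' \<cdot>\<^sub>v v" "complexify (transpose_mat R) *\<^sub>v v = cnj l' \<cdot>\<^sub>v v"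
      unfolding v_def using w' cw
      by (simp_all add: mult_mat_vec[OF C] mult_mat_vec[OF Cd] smult_smult_assoc mult_ac)
    have iso: "v \<bullet> v = 0"
      by (rule bilinear_eigenvectors_orthogonal[OF R v v eigv(1)]) (use eigv w'(3) in auto)
    note ip = isotropic_vector_re_im[OF v vv iso]
    have "reduces_on R n 2 (\<lambda>i. [re_vec v, - im_vec v] ! i) (rot_block (Re l') (Im l'))"
    proof (rule reduces_on_rot_block)
      show "re_vec v \<bullet> re_vec v = 1" "- im_vec v \<bullet> - im_vec v = 1" "re_vec v \<bullet> - im_vec v = 0"
        using ip v by simp_all
      show "R *\<^sub>v re_vec v = Re l' \<cdot>\<^sub>v re_vec v + Im l' \<cdot>\<^sub>v - im_vec v"
        "R *\<^sub>v - im_vec v = - Im l' \<cdot>\<^sub>v re_vec v + Re l' \<cdot>\<^sub>v - im_vec v"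
        unfolding complexify_mult_vec_re_im[OF R v] complexify_mult_vec_neg_im[OF R v] eigv re_neg_im_smult[OF v] by simp_all
      show "transpose_mat R *\<^sub>v re_vec v = Re l' \<cdot>\<^sub>v re_vec v + - Im l' \<cdot>\<^sub>v - im_vec v"
        "transpose_mat R *\<^sub>v - im_vec v = Im l' \<cdot>\<^sub>v re_vec v + Re l' \<cdot>\<^sub>v - im_vec v"
        unfolding complexify_mult_vec_re_im[OF T v] complexify_mult_vec_neg_im[OF T v] eigv re_neg_im_smult[OF v] by simp_all
    qed (use v in simp_all)
    moreover have "rot_block (Re l') (Im l') \<in> real_blocks" using w'(3) by (rule real_blocksI)
    ultimately show ?thesis by (metis pos2)
  qed
qed

locale real_normal_square = normal_square "complexify R" n for R :: "real mat" and n :: nat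
begin

lemma R: "R \<in> carrier_mat n n" and T: "transpose_mat R \<in> carrier_mat n n"
  using A by auto

lemma joint_eigenvector_conjugate:
  assumes "joint_eigenvector x s r v"
  shows "joint_eigenvector (cnj x) (cnj s) (cnj r) (conjugate v)"
proof -
  have v: "v \<in> carrier_vec n" using assms unfolding joint_eigenvector_def by blast
  have "complexify (transpose_mat R) *\<^sub>v v \<in> carrier_vec n" "complexify R *\<^sub>v v \<in> carrier_vec n"
    using A_carrier[OF v] Ad_carrier[OF v] by simp_all
  then show ?thesis
    using assms v unfolding joint_eigenvector_def adjoint_complexify
    by (simp add: complexify_mult_vec_conjugate[OF R] complexify_mult_vec_conjugate[OF T] conjugate_smult_vec)
qed

text \<open>
  For real \<open>x\<close> all three eigenvalues are real, and the joint eigenspace contains the real and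
  imaginary parts of its vectors. With a real \<open>f\<close> the whole plane of
  \<open>joint_eigenvector_pair\<close> is real.
\<close>

lemma reducing_block2:
  assumes E: "joint_eigenvector x (complex_of_real s) (complex_of_real r) f" "f \<noteq> 0\<^sub>v n"
    and sr: "0 \<le> r" "r < s" and x: "Im x = 0"
  shows "\<exists>k q B. k > 0 \<and> B \<in> real_blocks \<and> reduces_on R n k q B"
proof -
  let ?c = "map_vec complex_of_real"
  have f: "f \<in> carrier_vec n" using E unfolding joint_eigenvector_def by blast
  have cx: "cnj x = x" using x by (simp add: complex_eq_iff)
  have Ec: "joint_eigenvector x (complex_of_real s) (complex_of_real r) (conjugate f)"
    using joint_eigenvector_conjugate[OF E(1)] cx by simp
  have "joint_eigenvector x (complex_of_real s) (complex_of_real r) (?c (re_vec f))"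
  proof -
    have "?c (re_vec f) = (1 / 2) \<cdot>\<^sub>v (f - (- 1) \<cdot>\<^sub>v conjugate f)"
      using f by (intro eq_vecI) (auto simp: complex_eq_iff)
    then show ?thesis
      using joint_eigenvector_smult[OF joint_eigenvector_minus[OF E(1) joint_eigenvector_smult[OF Ec]]] by metis
  qed
  moreover have "joint_eigenvector x (complex_of_real s) (complex_of_real r) (?c (im_vec f))"
  proof -
    have "?c (im_vec f) = (- \<i> / 2) \<cdot>\<^sub>v (f - conjugate f)"
      using f by (intro eq_vecI) (auto simp: complex_eq_iff)
    then show ?thesis
      using joint_eigenvector_smult[OF joint_eigenvector_minus[OF E(1) Ec]] by metis
  qed
  ultimately obtain u0 where u0: "u0 \<in> carrier_vec n" "u0 \<noteq> 0\<^sub>v n"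
    "joint_eigenvector x (complex_of_real s) (complex_of_real r) (?c u0)"
    using re_im_vec_zero[OF f] E(2) f by (metis map_carrier_vec)
  obtain a where a: "(a \<cdot>\<^sub>v u0) \<bullet> (a \<cdot>\<^sub>v u0) = 1" using unit_multiple_exists_real[OF u0(1,2)] .
  define u where "u = a \<cdot>\<^sub>v u0"
  have u: "u \<in> carrier_vec n" unfolding u_def using u0 by simp
  have cu: "?c u = complex_of_real a \<cdot>\<^sub>v ?c u0" unfolding u_def using u0 by (intro eq_vecI) auto
  have Eu: "joint_eigenvector x (complex_of_real s) (complex_of_real r) (?c u)"
    unfolding cu by (rule joint_eigenvector_smult[OF u0(3)])
  have ip: "?c v \<bullet>c ?c w = complex_of_real (v \<bullet> w)" if "v \<in> carrier_vec n" "w \<in> carrier_vec n" for v w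
    using that by (simp add: scalar_prod_def)
  have unit: "?c u \<bullet>c ?c u = 1" using ip[OF u u] a unfolding u_def by simp
  define t \<nu> where "t = sqrt s" and "\<nu> = Re x / s"
  define v where "v = (1 / t) \<cdot>\<^sub>v (R *\<^sub>v u)"
  have v: "v \<in> carrier_vec n" unfolding v_def using R u by simp
  have hom: "complexify M *\<^sub>v ?c z = ?c (M *\<^sub>v z)" if "M \<in> carrier_mat n n" "z \<in> carrier_vec n" for M z
    by (rule of_real_hom.mult_mat_vec_hom[OF that, symmetric])
  have smult: "complex_of_real b \<cdot>\<^sub>v ?c z = ?c (b \<cdot>\<^sub>v z)" for b z by (intro eq_vecI) auto
  have inj: "?c y = ?c z \<longleftrightarrow> y = z" for y z by (metis of_real_hom.vec_hom_inj)
  have cv: "(1 / complex_of_real (sqrt s)) \<cdot>\<^sub>v (complexify R *\<^sub>v ?c u) = ?c v"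
    unfolding v_def t_def hom[OF R u] using smult[of "1 / sqrt s" "R *\<^sub>v u"] by simp
  have x': "x / complex_of_real s = complex_of_real \<nu>" unfolding \<nu>_def using x by (simp add: complex_eq_iff)
  note pair = joint_eigenvector_pair[OF Eu unit sr, unfolded cv x' adjoint_complexify, folded t_def]
  have "reduces_on R n 2 (\<lambda>i. [v, u] ! i) (block2 t \<nu>)"
  proof (rule reduces_on_block2)
    show "v \<bullet> v = 1" "v \<bullet> u = 0"
      using pair(2,3) unfolding ip[OF v v] ip[OF v u] by (simp_all flip: of_real_eq_iff)
    show "u \<bullet> u = 1" using a unfolding u_def .
    show "R *\<^sub>v u = t \<cdot>\<^sub>v v" using pair(5) unfolding hom[OF R u] smult inj .
    show "R *\<^sub>v v = (t * \<nu>) \<cdot>\<^sub>v u" using pair(6) unfolding hom[OF R v] of_real_mult[symmetric] smult inj .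
    show "transpose_mat R *\<^sub>v v = t \<cdot>\<^sub>v u" using pair(7) unfolding hom[OF T v] smult inj .
    show "transpose_mat R *\<^sub>v u = (t * \<nu>) \<cdot>\<^sub>v v"
      using pair(8) unfolding hom[OF T u] complex_cnj_complex_of_real of_real_mult[symmetric] smult inj .
  qed (use u v in auto)
  moreover have "block2 t \<nu> \<in> real_blocks"
    using pair(4) sr unfolding t_def by (intro real_blocksI) auto
  ultimately show ?thesis by (metis pos2)
qed

text \<open>
  For nonreal \<open>x\<close> the plane of \<open>joint_eigenvector_pair\<close> is orthogonal to its complex conjugate,
  because \<open>A\<^sup>2\<close> has the eigenvalue \<open>x\<close> on the one and \<open>cnj x\<close> on the other. The real and negative
  imaginary parts of its basis, scaled by \<open>\<surd>2\<close>, are then four orthonormal real vectors.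
\<close>

lemma reducing_block4:
  assumes E: "joint_eigenvector x (complex_of_real s) (complex_of_real r) f" "f \<noteq> 0\<^sub>v n"
    and sr: "0 \<le> r" "r < s" and x: "Im x > 0"
  shows "\<exists>k q B. k > 0 \<and> B \<in> real_blocks \<and> reduces_on R n k q B"
proof -
  have f: "f \<in> carrier_vec n" using E unfolding joint_eigenvector_def by blast
  obtain a where a: "(a \<cdot>\<^sub>v f) \<bullet>c (a \<cdot>\<^sub>v f) = 1" using unit_multiple_exists[OF f E(2)] .
  define g where "g = a \<cdot>\<^sub>v f"
  have Eg: "joint_eigenvector x (complex_of_real s) (complex_of_real r) g"
    unfolding g_def by (rule joint_eigenvector_smult[OF E(1)])
  have unit: "g \<bullet>c g = 1" using a unfolding g_def .
  define t \<nu> where "t = sqrt s" and "\<nu> = x / complex_of_real s"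
  define e where "e = (1 / complex_of_real t) \<cdot>\<^sub>v (complexify R *\<^sub>v g)"
  note pair = joint_eigenvector_pair[OF Eg unit sr, folded t_def \<nu>_def, folded e_def, unfolded adjoint_complexify]
  let ?w = "complex_of_real (sqrt 2)"
  define G H where "G = ?w \<cdot>\<^sub>v g" and "H = ?w \<cdot>\<^sub>v e"
  have EG: "joint_eigenvector x (complex_of_real s) (complex_of_real r) G"
    and EH: "joint_eigenvector x (complex_of_real r) (complex_of_real s) H"
    unfolding G_def H_def using joint_eigenvector_smult Eg pair(1) by blast+
  have g: "g \<in> carrier_vec n" and e: "e \<in> carrier_vec n" and G: "G \<in> carrier_vec n" and H: "H \<in> carrier_vec n"
    using Eg pair(1) EG EH unfolding joint_eigenvector_def by blast+
  have scale: "(?w \<cdot>\<^sub>v y) \<bullet>c (?w \<cdot>\<^sub>v z) = 2 * (y \<bullet>c z)" if "y \<in> carrier_vec n" "z \<in> carrier_vec n" for y z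
    using that cscalar_prod_smult_left[of y n "?w \<cdot>\<^sub>v z" ?w] cscalar_prod_smult_right[OF that, of ?w]
    by (simp flip: of_real_mult mult.assoc)
  have ips: "G \<bullet>c G = 2" "H \<bullet>c H = 2" "H \<bullet>c G = 0"
    unfolding G_def H_def scale[OF g g] scale[OF e e] scale[OF e g] using unit pair(2,3) by simp_all
  have RR: "R * R \<in> carrier_mat n n" using R by simp
  have cRR: "complexify (R * R) = complexify R * complexify R" by (rule complexify_mult[OF R R])
  have iso: "y \<bullet> z = 0"
    if "joint_eigenvector x s1 r1 y" "joint_eigenvector x s2 r2 z" for y z s1 r1 s2 r2
  proof (rule bilinear_eigenvectors_orthogonal[OF RR])
    show y: "y \<in> carrier_vec n" and z: "z \<in> carrier_vec n" using that unfolding joint_eigenvector_def by blast+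
    show "complexify (R * R) *\<^sub>v y = x \<cdot>\<^sub>v y"
      unfolding cRR using that(1) assoc_mult_mat_vec[OF A A y] unfolding joint_eigenvector_def by simp
    show "mat_adjoint (complexify (R * R)) *\<^sub>v z = cnj x \<cdot>\<^sub>v z"
      unfolding cRR adjoint_AA using joint_eigenvector_adjoint_square[OF that(2)] assoc_mult_mat_vec[OF Ad Ad z] by simp
  qed (use x in simp)
  note Gip = isotropic_vector_re_im[OF G ips(1) iso[OF EG EG]]
  note Hip = isotropic_vector_re_im[OF H ips(2) iso[OF EH EH]]
  note HGip = isotropic_pair_re_im[OF H G ips(3) iso[OF EH EG]]
  have act: "complexify R *\<^sub>v G = complex_of_real t \<cdot>\<^sub>v H" "complexify R *\<^sub>v H = (complex_of_real t * \<nu>) \<cdot>\<^sub>v G"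
    "complexify (transpose_mat R) *\<^sub>v H = complex_of_real t \<cdot>\<^sub>v G"
    "complexify (transpose_mat R) *\<^sub>v G = (complex_of_real t * cnj \<nu>) \<cdot>\<^sub>v H"
    unfolding G_def H_def
    using A_smult[OF g] A_smult[OF e] Ad_smult[OF g] Ad_smult[OF e] pair(5-8)
    by (simp_all add: smult_smult_assoc mult_ac)
  let ?x0 = "re_vec H" and ?x1 = "- im_vec H" and ?x2 = "re_vec G" and ?x3 = "- im_vec G"
  have "reduces_on R n 4 (\<lambda>i. [?x0, ?x1, ?x2, ?x3] ! i) (block4 t (Re \<nu>) (Im \<nu>))"
  proof (rule reduces_on_block4)
    show "?x0 \<bullet> ?x0 = 1" "?x1 \<bullet> ?x1 = 1" "?x2 \<bullet> ?x2 = 1" "?x3 \<bullet> ?x3 = 1" "?x0 \<bullet> ?x1 = 0" "?x0 \<bullet> ?x2 = 0"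
      "?x0 \<bullet> ?x3 = 0" "?x1 \<bullet> ?x2 = 0" "?x1 \<bullet> ?x3 = 0" "?x2 \<bullet> ?x3 = 0"
      using Gip Hip HGip G H by simp_all
    have z: "0 \<cdot>\<^sub>v y = 0\<^sub>v n" if "y \<in> carrier_vec n" for y :: "real vec" using that by (intro eq_vecI) auto
    show "R *\<^sub>v ?x0 = (t * Re \<nu>) \<cdot>\<^sub>v ?x2 + (t * Im \<nu>) \<cdot>\<^sub>v ?x3" "R *\<^sub>v ?x1 = - (t * Im \<nu>) \<cdot>\<^sub>v ?x2 + (t * Re \<nu>) \<cdot>\<^sub>v ?x3"
      unfolding complexify_mult_vec_re_im[OF R H] complexify_mult_vec_neg_im[OF R H] act re_neg_im_smult[OF G] by simp_all
    show "R *\<^sub>v ?x2 = t \<cdot>\<^sub>v ?x0" "R *\<^sub>v ?x3 = t \<cdot>\<^sub>v ?x1"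
      unfolding complexify_mult_vec_re_im[OF R G] complexify_mult_vec_neg_im[OF R G] act re_neg_im_smult[OF H]
      using H by (simp_all add: z)
    show "transpose_mat R *\<^sub>v ?x0 = t \<cdot>\<^sub>v ?x2" "transpose_mat R *\<^sub>v ?x1 = t \<cdot>\<^sub>v ?x3"
      unfolding complexify_mult_vec_re_im[OF T H] complexify_mult_vec_neg_im[OF T H] act re_neg_im_smult[OF G]
      using G by (simp_all add: z)
    show "transpose_mat R *\<^sub>v ?x2 = (t * Re \<nu>) \<cdot>\<^sub>v ?x0 + - (t * Im \<nu>) \<cdot>\<^sub>v ?x1"
      "transpose_mat R *\<^sub>v ?x3 = (t * Im \<nu>) \<cdot>\<^sub>v ?x0 + (t * Re \<nu>) \<cdot>\<^sub>v ?x1"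
      unfolding complexify_mult_vec_re_im[OF T G] complexify_mult_vec_neg_im[OF T G] act re_neg_im_smult[OF H] by simp_all
  qed (use G H in simp_all)
  moreover have "block4 t (Re \<nu>) (Im \<nu>) \<in> real_blocks"
  proof -
    have "(Re \<nu>)\<^sup>2 + (Im \<nu>)\<^sup>2 < 1"
      using pair(4) by (simp add: cmod_def)
    moreover have "Im \<nu> > 0" "t > 0" using x sr unfolding \<nu>_def t_def by simp_all
    ultimately show ?thesis by (intro real_blocksI)
  qed
  ultimately show ?thesis by (metis zero_less_numeral)
qed

lemma reducing_block_exists:
  assumes "n > 0"
  shows "\<exists>k q B. k > 0 \<and> B \<in> real_blocks \<and> reduces_on R n k q B"
  using normal_eigenvector_or_joint_eigenvector[OF assms]
proof (elim disjE exE conjE)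
  fix w l assume "w \<in> carrier_vec n" "w \<noteq> 0\<^sub>v n" "complexify R *\<^sub>v w = l \<cdot>\<^sub>v w" "Ad *\<^sub>v w = cnj l \<cdot>\<^sub>v w"
  then show ?thesis by (rule reducing_block_of_normal_eigenvector[OF R])
next
  fix x s r f assume *: "joint_eigenvector x (complex_of_real s) (complex_of_real r) f" "f \<noteq> 0\<^sub>v n" "0 \<le> r" "r < s"
  consider "Im x = 0" | "Im x > 0" | "Im x < 0" by linarith
  then show ?thesis
  proof cases
    case 1
    then show ?thesis using reducing_block2[OF *] by blast
  next
    case 2
    then show ?thesis using reducing_block4[OF *] by blast
  next
    case 3
    have "conjugate f \<noteq> 0\<^sub>v n" using *(2) by simp
    then show ?thesis using reducing_block4[of "cnj x" s r "conjugate f"] joint_eigenvector_conjugate[OF *(1)] * 3 by simp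
  qed
qed

end

lemma real_blocks_square: "B \<in> real_blocks \<Longrightarrow> square_mat B"
  unfolding real_blocks_def by auto

text \<open>
  Split off one block and continue with the complementary diagonal block, whose square is again
  normal.
\<close>

theorem real_canonical_form_exists:
  assumes "R \<in> carrier_mat n n" "normal_mat (complexify R ^\<^sub>m 2)"
  shows "\<exists>Bs. real_canonical_form R Bs"
  using assms
proof (induction n arbitrary: R rule: less_induct)
  case (less n)
  show ?case
  proof (cases "n = 0")
    case True
    then have "R = 0\<^sub>m 0 0" using less.prems(1) by (intro eq_matI) auto
    moreover have "orthogonally_similar (0\<^sub>m 0 0) (0\<^sub>m 0 0)"
      by (rule orthogonally_similarI[of _ 0 "0\<^sub>m 0 0"]) (auto intro!: eq_matI)
    ultimately have "real_canonical_form R []" unfolding real_canonical_form_def by simp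
    then show ?thesis by blast
  next
    case False
    interpret real_normal_square R n
      by unfold_locales (use less.prems in auto)
    obtain k q B where k: "k > 0" and B: "B \<in> real_blocks" and red: "reduces_on R n k q B"
      using reducing_block_exists False by blast
    obtain D where D: "D \<in> carrier_mat (n - k) (n - k)" and kn: "k \<le> n"
      and sim: "orthogonally_similar R (four_block_mat B (0\<^sub>m k (n - k)) (0\<^sub>m (n - k) k) D)"
      using reducing_subspace_splits[OF less.prems(1) red] by blast
    have Bc: "B \<in> carrier_mat k k" using red unfolding reduces_on_def by blast
    have cF: "complexify (four_block_mat B (0\<^sub>m k (n - k)) (0\<^sub>m (n - k) k) D) =
        four_block_mat (complexify B) (0\<^sub>m k (n - k)) (0\<^sub>m (n - k) k) (complexify D)"
      using Bc D by (intro eq_matI) auto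
    have "normal_mat (complexify (four_block_mat B (0\<^sub>m k (n - k)) (0\<^sub>m (n - k) k) D) ^\<^sub>m 2)"
      using normal_square_unitarily_similar[OF orthogonally_similar_imp_unitarily_similar[OF sim less.prems(1)] A] normal
      by blast
    then have "normal_mat (complexify D ^\<^sub>m 2)"
      unfolding cF using normal_square_four_block[of "complexify B" k "complexify D" "n - k"] Bc D by simp
    then obtain Bs where Bs: "real_canonical_form D Bs"
      using less.IH[of "n - k" D] D k kn by auto
    then have simD: "orthogonally_similar D (diag_block_mat Bs)" unfolding real_canonical_form_def by blast
    have diag: "diag_block_mat Bs \<in> carrier_mat (n - k) (n - k)" using orthogonally_similarE[OF simD D] by metis
    have "orthogonally_similar R (diag_block_mat (B # Bs))"
      unfolding diag_block_mat_Cons_square[OF Bc diag]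
      by (rule orthogonally_similar_trans[OF sim orthogonally_similar_four_block[OF simD D Bc] less.prems(1)])
    then have "real_canonical_form R (B # Bs)" using Bs B unfolding real_canonical_form_def by simp
    then show ?thesis by blast
  qed
qed

section \<open>Splitting real blocks over the complex numbers\<close>

text \<open>
  Checking \<open>M S = S N\<close> instead of \<open>N = S\<^sup>* M S\<close> leaves a single matrix product on each side.
\<close>

lemma unitarily_similar_intertwineI:
  assumes "M \<in> carrier_mat n n" "N \<in> carrier_mat n n" "S \<in> carrier_mat n n"
    and "mat_adjoint S * S = 1\<^sub>m n" "M * S = S * N"
  shows "unitarily_similar M N"
proof (rule unitarily_similarI[OF assms(1,3,4)])
  have S: "mat_adjoint S \<in> carrier_mat n n" using assms(3) by simp
  have "mat_adjoint S * M * S = mat_adjoint S * (S * N)"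
    using assoc_mult_mat[OF S assms(1,3)] assms(5) by simp
  also have "\<dots> = mat_adjoint S * S * N" using assoc_mult_mat[OF S assms(3,2)] by simp
  also have "\<dots> = N" unfolding assms(4) using assms(2) by simp
  finally show "N = mat_adjoint S * M * S" ..
qed

lemma unitarily_similar_refl: "M \<in> carrier_mat n n \<Longrightarrow> unitarily_similar M M"
  by (rule unitarily_similar_intertwineI[of _ n _ "1\<^sub>m n"]) auto

lemma index_mult_square:
  "M \<in> carrier_mat n n \<Longrightarrow> N \<in> carrier_mat n n \<Longrightarrow> i < n \<Longrightarrow> j < n \<Longrightarrow>
    (M * N) $$ (i, j) = (\<Sum>k\<in>{0..<n}. M $$ (i, k) * N $$ (k, j))"
  by (simp add: scalar_prod_def)

lemma atLeastLessThan_1_2_4: "{0..<1::nat} = {0}" "{0..<2::nat} = {0, 1}" "{0..<4::nat} = {0, 1, 2, 3}"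
  by auto

lemma square_mat_eqI:
  assumes "M \<in> carrier_mat n n" "N \<in> carrier_mat n n" "\<forall>i<n. \<forall>j<n. M $$ (i, j) = N $$ (i, j)"
  shows "M = N"
  using assms by (intro eq_matI) auto

text \<open>
  The vectors \<open>(1, \<mp>\<i>) / \<surd>2\<close> are unit eigenvectors of \<open>[[a, -b], [b, a]]\<close> for the eigenvalues
  \<open>a \<plusminus> b \<i>\<close>.
\<close>

lemma rot_block_unitarily_similar:
  "unitarily_similar (complexify (rot_block a b))
    (diag_block_mat [block1 (Complex a b), block1 (Complex a (- b))])"
proof -
  define r :: complex where "r = of_real (1 / sqrt 2)"
  have rr: "r * r = 1 / 2" unfolding r_def by (simp flip: of_real_mult)
  have "\<i> * r * (\<i> * r) = (\<i> * \<i>) * (r * r)" by (simp only: mult_ac)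
  then have r: "cnj r = r" "r * r = 1 / 2" "\<i> * r * (\<i> * r) = - (1 / 2)" unfolding rr by (simp_all add: r_def)
  define S where "S = mat_of_rows_list 2 [[r, r], [- \<i> * r, \<i> * r]]"
  let ?N = "diag_block_mat [block1 (Complex a b), block1 (Complex a (- b))]"
  have S: "S \<in> carrier_mat 2 2" unfolding S_def by (rule carrier_matI) (simp_all add: mat_of_rows_list_def)
  have N: "?N \<in> carrier_mat 2 2" by (rule carrier_matI) (simp_all add: Let_def)
  have M: "complexify (rot_block a b) \<in> carrier_mat 2 2" by simp
  have Sa: "mat_adjoint S \<in> carrier_mat 2 2" using S by simp
  have iS: "S $$ (0, 0) = r" "S $$ (0, Suc 0) = r" "S $$ (Suc 0, 0) = - \<i> * r" "S $$ (Suc 0, Suc 0) = \<i> * r"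
    unfolding S_def by (simp_all add: mat_of_rows_list_def)
  have dS: "dim_row S = 2" "dim_col S = 2" using S by auto
  have iN: "?N $$ (0, 0) = Complex a b" "?N $$ (0, Suc 0) = 0" "?N $$ (Suc 0, 0) = 0" "?N $$ (Suc 0, Suc 0) = Complex a (- b)"
    by (simp_all add: Let_def)
  show ?thesis
  proof (rule unitarily_similar_intertwineI[OF M N S])
    show "mat_adjoint S * S = 1\<^sub>m 2"
      by (rule square_mat_eqI[OF mult_carrier_mat[OF Sa S] one_carrier_mat])
         (simp add: all_less_1_2_4 index_mult_square[OF Sa S] atLeastLessThan_1_2_4 dS iS r del: index_mult_mat)
    show "complexify (rot_block a b) * S = S * ?N"
      by (rule square_mat_eqI[OF mult_carrier_mat[OF M S] mult_carrier_mat[OF S N]])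
         (simp add: all_less_1_2_4 index_mult_square[OF M S] index_mult_square[OF S N] atLeastLessThan_1_2_4 dS iS iN
            complex_eq_iff r_def del: index_mult_mat diag_block_mat.simps)
  qed
qed

text \<open>
  The lower left corner of the \<open>4 \<times> 4\<close> block is \<open>[[c, -d], [d, c]]\<close>, with unit eigenvector
  \<open>u = (1, -\<i>) / \<surd>2\<close> for \<open>c + d \<i>\<close>. The pairs \<open>(u, 0), (0, u)\<close> and their conjugates span
  invariant planes with the two complex blocks.
\<close>

lemma block4_unitarily_similar:
  "unitarily_similar (complexify (block4 t c d))
    (diag_block_mat [block2 (complex_of_real t) (Complex c d), block2 (complex_of_real t) (Complex c (- d))])"
proof -
  define r :: complex where "r = of_real (1 / sqrt 2)"
  have rr: "r * r = 1 / 2" unfolding r_def by (simp flip: of_real_mult)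
  have "\<i> * r * (\<i> * r) = (\<i> * \<i>) * (r * r)" by (simp only: mult_ac)
  then have r: "cnj r = r" "r * r = 1 / 2" "\<i> * r * (\<i> * r) = - (1 / 2)" unfolding rr by (simp_all add: r_def)
  define S where "S = mat_of_rows_list 4
    [[r, 0, r, 0], [- \<i> * r, 0, \<i> * r, 0], [0, r, 0, r], [0, - \<i> * r, 0, \<i> * r]]"
  let ?N = "diag_block_mat [block2 (complex_of_real t) (Complex c d), block2 (complex_of_real t) (Complex c (- d))]"
  have S: "S \<in> carrier_mat 4 4" unfolding S_def by (rule carrier_matI) (simp_all add: mat_of_rows_list_def)
  have N: "?N \<in> carrier_mat 4 4" by (rule carrier_matI) (simp_all add: Let_def)
  have M: "complexify (block4 t c d) \<in> carrier_mat 4 4" by simp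
  have Sa: "mat_adjoint S \<in> carrier_mat 4 4" using S by simp
  have iS: "S $$ (i, j) = [[r, 0, r, 0], [- \<i> * r, 0, \<i> * r, 0], [0, r, 0, r], [0, - \<i> * r, 0, \<i> * r]] ! i ! j"
    if "i < 4" "j < 4" for i j
    unfolding S_def using that by (simp add: mat_of_rows_list_def)
  have dS: "dim_row S = 4" "dim_col S = 4" using S by auto
  have iN: "?N $$ (i, j) = complex_of_real t * ([[0, 1, 0, 0], [Complex c d, 0, 0, 0], [0, 0, 0, 1], [0, 0, Complex c (- d), 0]] ! i ! j)"
    if "i < 4" "j < 4" for i j
  proof -
    have "\<forall>i<4. \<forall>j<4. ?N $$ (i, j) = complex_of_real t * ([[0, 1, 0, 0], [Complex c d, 0, 0, 0], [0, 0, 0, 1], [0, 0, Complex c (- d), 0]] ! i ! j)"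
      by (simp add: all_less_1_2_4 Let_def)
    then show ?thesis using that by blast
  qed
  show ?thesis
  proof (rule unitarily_similar_intertwineI[OF M N S])
    show "mat_adjoint S * S = 1\<^sub>m 4"
      by (rule square_mat_eqI[OF mult_carrier_mat[OF Sa S] one_carrier_mat])
         (simp add: all_less_1_2_4 index_mult_square[OF Sa S] atLeastLessThan_1_2_4 dS iS r del: index_mult_mat)
    show "complexify (block4 t c d) * S = S * ?N"
      by (rule square_mat_eqI[OF mult_carrier_mat[OF M S] mult_carrier_mat[OF S N]])
         (simp add: all_less_1_2_4 index_mult_square[OF M S] index_mult_square[OF S N] atLeastLessThan_1_2_4 dS iS iN
            index_block4 complex_eq_iff r_def del: index_mult_mat diag_block_mat.simps)
  qed
qed

text \<open>
  The direct sum of complex blocks that a real block replaces. The shape of the block is recognised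
  from its entries: among \<open>2 \<times> 2\<close> blocks only those with \<open>b > 0\<close> in the upper right position
  \<open>-b\<close> have a negative entry there. In the \<open>4 \<times> 4\<close> block the scaling \<open>t\<close> is an entry and
  is divided out.
\<close>

definition complex_split :: "real mat \<Rightarrow> complex mat list" where
  "complex_split B =
    (if dim_row B = 2 \<and> B $$ (0, 1) < 0 then
       [block1 (Complex (B $$ (0, 0)) (B $$ (1, 0))), block1 (Complex (B $$ (0, 0)) (- (B $$ (1, 0))))]
     else if dim_row B = 4 then
       let t = B $$ (0, 2); c = B $$ (2, 0) / t; d = B $$ (3, 0) / t
       in [block2 (complex_of_real t) (Complex c d), block2 (complex_of_real t) (Complex c (- d))]
     else [complexify B])"

lemma complex_split_block1: "complex_split (block1 l) = [block1 (complex_of_real l)]"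
  by (simp add: complex_split_def complexify_block1)

lemma complex_split_block2: "t > 0 \<Longrightarrow> complex_split (block2 t \<nu>) = [block2 (complex_of_real t) (complex_of_real \<nu>)]"
  by (simp add: complex_split_def complexify_block2)

lemma complex_split_rot_block:
  "b > 0 \<Longrightarrow> complex_split (rot_block a b) = [block1 (Complex a b), block1 (Complex a (- b))]"
  by (simp add: complex_split_def)

lemma complex_split_block4:
  "t > 0 \<Longrightarrow> complex_split (block4 t c d) =
    [block2 (complex_of_real t) (Complex c d), block2 (complex_of_real t) (Complex c (- d))]"
  by (simp add: complex_split_def index_block4)

lemmas complex_split_simps =
  complex_split_block1 complex_split_block2 complex_split_rot_block complex_split_block4

lemma real_blocks_cases:
  assumes "B \<in> real_blocks"
  obtains (block1) l where "B = block1 l"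
    | (block2) t \<nu> where "B = block2 t \<nu>" "t > 0" "\<bar>\<nu>\<bar> < 1"
    | (rot_block) a b where "B = rot_block a b" "b > 0"
    | (block4) t c d where "B = block4 t c d" "t > 0" "d > 0" "c\<^sup>2 + d\<^sup>2 < 1"
  using assms unfolding real_blocks_def by auto

lemma complex_blocksI:
  "block1 l \<in> complex_blocks"
  "t > 0 \<Longrightarrow> cmod \<nu> < 1 \<Longrightarrow> block2 (complex_of_real t) \<nu> \<in> complex_blocks"
  unfolding complex_blocks_def by blast+

lemma complex_split_complex_blocks:
  assumes "B \<in> real_blocks"
  shows "set (complex_split B) \<subseteq> complex_blocks"
  using assms
proof (cases rule: real_blocks_cases)
  case (block4 t c d)
  have "cmod (Complex c d) < 1" "cmod (Complex c (- d)) < 1" using block4(4) by (simp_all add: complex_norm)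
  then show ?thesis using block4 by (simp add: complex_split_simps complex_blocksI)
next
  case (block2 t \<nu>)
  have "cmod (complex_of_real \<nu>) < 1" using block2(3) by simp
  then show ?thesis using block2(1,2) by (simp add: complex_split_simps complex_blocksI)
qed (simp_all add: complex_split_simps complex_blocksI)

lemma complexify_unitarily_similar_split:
  assumes "B \<in> real_blocks"
  shows "unitarily_similar (complexify B) (diag_block_mat (complex_split B))"
  using assms
proof (cases rule: real_blocks_cases)
  case (block1 l)
  then show ?thesis
    using unitarily_similar_refl[OF block1_carrier, of "complex_of_real l"]
    by (simp add: complex_split_simps complexify_block1 del: diag_block_mat.simps)
next
  case (block2 t \<nu>)
  then show ?thesis
    using unitarily_similar_refl[OF block2_carrier, of "complex_of_real t" "complex_of_real \<nu>"]
    by (simp add: complex_split_simps complexify_block2 del: diag_block_mat.simps)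
next
  case (rot_block a b)
  then show ?thesis using rot_block_unitarily_similar by (simp only: complex_split_simps)
next
  case (block4 t c d)
  then show ?thesis using block4_unitarily_similar by (simp only: complex_split_simps)
qed

lemma complex_blocks_square: "C \<in> complex_blocks \<Longrightarrow> square_mat C"
  unfolding complex_blocks_def by auto

lemma char_poly_pencil_real_sum:
  assumes "set Bs \<subseteq> real_blocks"
  shows "char_poly (anticommutator_pencil s (complexify (diag_block_mat Bs))) =
    char_poly (anticommutator_pencil s (diag_block_mat (concat (map complex_split Bs))))"
proof -
  have "char_poly (anticommutator_pencil s (complexify (diag_block_mat Bs))) =
      (\<Prod>B\<leftarrow>Bs. char_poly (anticommutator_pencil s (complexify B)))"
    unfolding complexify_diag_block_mat
    using assms real_blocks_square by (subst char_poly_pencil_diag_block_mat) (auto simp: comp_def)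
  also have "\<dots> = (\<Prod>B\<leftarrow>Bs. \<Prod>C\<leftarrow>complex_split B. char_poly (anticommutator_pencil s C))"
  proof (intro arg_cong[where f = prod_list] map_cong refl)
    fix B assume "B \<in> set Bs"
    then have B: "B \<in> real_blocks" using assms by blast
    have "complexify B \<in> carrier_mat (dim_row B) (dim_row B)"
      using real_blocks_square[OF B] by auto
    then show "char_poly (anticommutator_pencil s (complexify B)) =
        (\<Prod>C\<leftarrow>complex_split B. char_poly (anticommutator_pencil s C))"
      using char_poly_pencil_unitarily_similar[OF complexify_unitarily_similar_split[OF B]]
        char_poly_pencil_diag_block_mat[of "complex_split B"] complex_split_complex_blocks[OF B] complex_blocks_square
      by (metis subsetD)
  qed
  also have "\<dots> = (\<Prod>C\<leftarrow>concat (map complex_split Bs). char_poly (anticommutator_pencil s C))"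
    by (induction Bs) auto
  also have "\<dots> = char_poly (anticommutator_pencil s (diag_block_mat (concat (map complex_split Bs))))"
    using assms complex_split_complex_blocks complex_blocks_square
    by (intro char_poly_pencil_diag_block_mat[symmetric]) fastforce
  finally show ?thesis .
qed

lemma concat_split_complex_blocks:
  "set Bs \<subseteq> real_blocks \<Longrightarrow> set (concat (map complex_split Bs)) \<subseteq> complex_blocks"
  using complex_split_complex_blocks by fastforce

lemma char_poly_pencil_real_canonical_form:
  assumes "A \<in> carrier_mat n n" "real_canonical_form A Bs"
  shows "char_poly (anticommutator_pencil s (complexify A)) =
    char_poly (anticommutator_pencil s (diag_block_mat (concat (map complex_split Bs))))"
proof -
  have Bs: "set Bs \<subseteq> real_blocks" and sim: "orthogonally_similar A (diag_block_mat Bs)"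
    using assms(2) unfolding real_canonical_form_def by auto
  have "complexify A \<in> carrier_mat n n" using assms(1) by simp
  then show ?thesis
    using char_poly_pencil_unitarily_similar[OF orthogonally_similar_imp_unitarily_similar[OF sim assms(1)]]
      char_poly_pencil_real_sum[OF Bs] by metis
qed

text \<open>
  Both lists have the pencil polynomials of \<open>A\<close>, so they agree up to order.
\<close>

theorem complex_canonical_form_of_real:
  assumes "A \<in> carrier_mat n n" "real_canonical_form A Bs" "complex_canonical_form (complexify A) Cs"
  shows "mset Cs = mset (concat (map complex_split Bs))"
proof (rule complex_sum_determined_by_pencil)
  show "set Cs \<subseteq> complex_blocks" using assms(3) unfolding complex_canonical_form_def by blast
  show "set (concat (map complex_split Bs)) \<subseteq> complex_blocks"
    using assms(2) unfolding real_canonical_form_def by (intro concat_split_complex_blocks) blast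
  fix s
  have "complexify A \<in> carrier_mat n n" using assms(1) by simp
  then show "char_poly (anticommutator_pencil s (diag_block_mat Cs)) =
      char_poly (anticommutator_pencil s (diag_block_mat (concat (map complex_split Bs))))"
    using char_poly_pencil_unitarily_similar[of "complexify A" "diag_block_mat Cs" n s] assms(3)
      char_poly_pencil_real_canonical_form[OF assms(1,2), of s]
    unfolding complex_canonical_form_def by metis
qed

text \<open>
  The head of a split has nonnegative imaginary part in its parameter, and a real block is
  determined by the one member of its split with this property.
\<close>

lemma hd_complex_split_determines_block:
  assumes "B \<in> real_blocks" "B' \<in> real_blocks" "hd (complex_split B) \<in> set (complex_split B')"
  shows "B = B'"
  using assms(1)
proof (cases rule: real_blocks_cases)
  case (block1 l)
  note B = this
  show ?thesis
    using assms(2)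
    by (cases rule: real_blocks_cases)
       (use assms(3) B in \<open>auto simp: complex_split_simps block2_eq_iff complex_eq_iff\<close>)
next
  case (block2 t \<nu>)
  note B = this
  show ?thesis
    using assms(2)
    by (cases rule: real_blocks_cases)
       (use assms(3) B in \<open>auto simp: complex_split_simps block2_eq_iff complex_eq_iff\<close>)
next
  case (rot_block a b)
  note B = this
  show ?thesis
    using assms(2)
    by (cases rule: real_blocks_cases)
       (use assms(3) B in \<open>auto simp: complex_split_simps block2_eq_iff complex_eq_iff\<close>)
next
  case (block4 t c d)
  note B = this
  have pos: "t * d \<noteq> - (t * d')" if "d' > 0" for d'
    using B(2,3) that by (smt (verit) mult_pos_pos)
  show ?thesis
    using assms(2)
    by (cases rule: real_blocks_cases)
       (use assms(3) B in \<open>auto simp: complex_split_simps block2_eq_iff complex_eq_iff pos\<close>)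
qed

lemma mset_concat_map: "mset (concat (map f xs)) = (\<Sum>x\<in>#mset xs. mset (f x))"
  by (induction xs) auto

theorem real_canonical_form_unique:
  assumes "A \<in> carrier_mat n n" "real_canonical_form A Bs" "real_canonical_form A Bs'"
  shows "mset Bs = mset Bs'"
proof -
  have Bs: "set Bs \<subseteq> real_blocks" "set Bs' \<subseteq> real_blocks"
    using assms unfolding real_canonical_form_def by auto
  have "mset (concat (map complex_split Bs)) = mset (concat (map complex_split Bs'))"
    using char_poly_pencil_real_canonical_form[OF assms(1,2)] char_poly_pencil_real_canonical_form[OF assms(1,3)]
    by (intro complex_sum_determined_by_pencil concat_split_complex_blocks Bs) metis
  then have eq: "(\<Sum>B\<in>#mset Bs. mset (complex_split B)) = (\<Sum>B\<in>#mset Bs'. mset (complex_split B))"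
    unfolding mset_concat_map .
  show ?thesis
  proof (rule mset_eq_by_pieces[where S = real_blocks and f = "\<lambda>B. mset (complex_split B)" and r = "\<lambda>B. hd (complex_split B)"])
    show "set_mset (mset Bs) \<subseteq> real_blocks" "set_mset (mset Bs') \<subseteq> real_blocks" using Bs by simp_all
    show "hd (complex_split B) \<in># mset (complex_split B)" for B
      by (simp add: complex_split_def Let_def)
    show "B = B'" if "B \<in> real_blocks" "B' \<in> real_blocks" "hd (complex_split B) \<in># mset (complex_split B')" for B B'
      using that hd_complex_split_determines_block by simp
  qed (fact eq)
qed

section \<open>Replacing pairs of complex blocks\<close>

lemma replace_pair_add:
  assumes "replace_pair M N"
  shows "replace_pair (M + L) (N + L)"
  using assms
proof cases
  case (1 b M' a)
  have "replace_pair ((M' + L) + {#block1 (Complex a b), block1 (Complex a (- b))#})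
      ((M' + L) + {#complexify (rot_block a b)#})"
    by (rule replace_pair.intros) (fact 1)
  then show ?thesis using 1 by (simp add: ac_simps)
next
  case (2 t d c M')
  have "replace_pair ((M' + L) + {#block2 (complex_of_real t) (Complex c d), block2 (complex_of_real t) (Complex c (- d))#})
      ((M' + L) + {#complexify (block4 t c d)#})"
    by (rule replace_pair.intros) (use 2 in auto)
  then show ?thesis using 2 by (simp add: ac_simps)
qed

lemma replace_pairs_add: "replace_pair\<^sup>*\<^sup>* M N \<Longrightarrow> replace_pair\<^sup>*\<^sup>* (M + L) (N + L)"
  by (induction rule: rtranclp_induct) (auto intro: rtranclp.rtrancl_into_rtrancl replace_pair_add)

lemma replace_pairs_complex_split:
  assumes "B \<in> real_blocks"
  shows "replace_pair\<^sup>*\<^sup>* (mset (complex_split B)) {#complexify B#}"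
  using assms
proof (cases rule: real_blocks_cases)
  case (rot_block a b)
  have "replace_pair (mset (complex_split B)) {#complexify B#}"
    using replace_pair.intros(1)[OF rot_block(2), of "{#}" a] rot_block by (simp add: complex_split_simps)
  then show ?thesis by blast
next
  case (block4 t c d)
  have "replace_pair (mset (complex_split B)) {#complexify B#}"
    using replace_pair.intros(2)[OF block4(2-4), of "{#}"] block4 by (simp add: complex_split_simps)
  then show ?thesis by blast
qed (auto simp: complex_split_simps complexify_block1 complexify_block2)

lemma replace_pairs_concat_split:
  assumes "set Bs \<subseteq> real_blocks"
  shows "replace_pair\<^sup>*\<^sup>* (mset (concat (map complex_split Bs))) (mset (map complexify Bs))"
  using assms
proof (induction Bs)
  case (Cons B Bs)
  have "replace_pair\<^sup>*\<^sup>* (mset (complex_split B) + mset (concat (map complex_split Bs)))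
      ({#complexify B#} + mset (concat (map complex_split Bs)))"
    using Cons.prems by (intro replace_pairs_add replace_pairs_complex_split) simp
  also have "replace_pair\<^sup>*\<^sup>* ({#complexify B#} + mset (concat (map complex_split Bs)))
      ({#complexify B#} + mset (map complexify Bs))"
    using replace_pairs_add[of _ _ "{#complexify B#}"] Cons by (simp add: add.commute)
  finally show ?case by simp
qed simp

text \<open>
  Both kinds of replaceable pairs contain a matrix with a nonreal entry.
\<close>

lemma no_replaceable_pair_in_complexified:
  "\<not> replace_pair (mset (map complexify Bs)) N"
proof
  have real: "Im (M $$ (i, j)) = 0" if "M \<in># mset (map complexify Bs)" "i < dim_row M" "j < dim_col M" for M i j
    using that by auto
  assume "replace_pair (mset (map complexify Bs)) N"
  then show False
  proof cases
    case (1 b M a)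
    then have "block1 (Complex a b) \<in># mset (map complexify Bs)" by simp
    then show False using real[of "block1 (Complex a b)" 0 0] 1 by simp
  next
    case (2 t d c M)
    then have "block2 (complex_of_real t) (Complex c d) \<in># mset (map complexify Bs)" by simp
    then show False using real[of "block2 (complex_of_real t) (Complex c d)" 1 0] 2 by simp
  qed
qed

section \<open>Normality of the square\<close>

text \<open>
  The square of every complex block is a scalar matrix.
\<close>

lemma normal_square_complex_block:
  assumes "C \<in> complex_blocks"
  shows "normal_mat (C ^\<^sub>m 2)"
proof -
  consider l where "C = block1 l" | t \<nu> where "C = block2 (complex_of_real t) \<nu>"
    using assms unfolding complex_blocks_def by auto
  then show ?thesis
  proof cases
    case 1
    define X where "X = C * C"
    have X: "X \<in> carrier_mat 1 1" unfolding X_def 1 by (rule mult_carrier_mat[of _ 1 1]) (rule block1_carrier)+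
    then have Xa: "mat_adjoint X \<in> carrier_mat 1 1" by simp
    have d: "dim_row X = 1" "dim_col X = 1" using X by auto
    have "mat_adjoint X * X = X * mat_adjoint X"
      by (rule square_mat_eqI[OF mult_carrier_mat[OF Xa X] mult_carrier_mat[OF X Xa]])
         (simp add: all_less_1_2_4 index_mult_square[OF Xa X] index_mult_square[OF X Xa] atLeastLessThan_1_2_4
            mult.commute d del: index_mult_mat One_nat_def)
    then show ?thesis
      unfolding normal_mat_def X_def using pow_mat_two[of C 1] 1 by (simp del: One_nat_def)
  next
    case 2
    have C: "C \<in> carrier_mat 2 2" unfolding 2 by simp
    define X where "X = C * C"
    have X: "X \<in> carrier_mat 2 2" unfolding X_def by (rule mult_carrier_mat[OF C C])
    then have Xa: "mat_adjoint X \<in> carrier_mat 2 2" by simp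
    have d: "dim_row X = 2" "dim_col X = 2" using X by auto
    have Xi: "X $$ (i, j) = (\<Sum>k\<in>{0..<2}. C $$ (i, k) * C $$ (k, j))" if "i < 2" "j < 2" for i j
      unfolding X_def using that by (rule index_mult_square[OF C C])
    have i: "X $$ (0, 0) = t * (t * \<nu>)" "X $$ (0, Suc 0) = 0" "X $$ (Suc 0, 0) = 0" "X $$ (Suc 0, Suc 0) = t * (t * \<nu>)"
      by (simp_all add: Xi atLeastLessThan_1_2_4 2)
    have "mat_adjoint X * X = X * mat_adjoint X"
      by (rule square_mat_eqI[OF mult_carrier_mat[OF Xa X] mult_carrier_mat[OF X Xa]])
         (simp add: all_less_1_2_4 index_mult_square[OF Xa X] index_mult_square[OF X Xa] atLeastLessThan_1_2_4
            mult.commute d i del: index_mult_mat)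
    then show ?thesis
      unfolding normal_mat_def X_def using pow_mat_two[OF C] by simp
  qed
qed

lemma normal_square_diag_block_mat:
  assumes "\<forall>M\<in>set Ms. square_mat M \<and> normal_mat (M ^\<^sub>m 2)"
  shows "normal_mat (diag_block_mat Ms ^\<^sub>m 2)"
  using assms
proof (induction Ms)
  case Nil
  have "(0\<^sub>m 0 0 :: complex mat) ^\<^sub>m 2 = 0\<^sub>m 0 0" by (intro eq_matI) auto
  then show ?case unfolding normal_mat_def by (auto intro!: eq_matI)
next
  case (Cons M Ms)
  let ?m = "sum_list (map dim_row Ms)"
  have M: "M \<in> carrier_mat (dim_row M) (dim_row M)" using Cons.prems by auto
  have Ms: "diag_block_mat Ms \<in> carrier_mat ?m ?m" using Cons.prems by (intro diag_block_mat_carrier) auto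
  show ?case
    unfolding diag_block_mat_Cons_square[OF M Ms] normal_square_four_block[OF M Ms]
    using Cons by simp
qed

lemma normal_square_real_block:
  assumes "B \<in> real_blocks"
  shows "normal_mat (complexify B ^\<^sub>m 2)"
proof -
  have "normal_mat (diag_block_mat (complex_split B) ^\<^sub>m 2)"
    using complex_split_complex_blocks[OF assms] normal_square_complex_block complex_blocks_square
    by (intro normal_square_diag_block_mat) blast
  moreover have "complexify B \<in> carrier_mat (dim_row B) (dim_row B)"
    using real_blocks_square[OF assms] by auto
  ultimately show ?thesis
    using normal_square_unitarily_similar[OF complexify_unitarily_similar_split[OF assms]] by blast
qed

lemma complexify_square: "A \<in> carrier_mat n n \<Longrightarrow> complexify (A ^\<^sub>m 2) = complexify A ^\<^sub>m 2"
  by (simp add: pow_mat_two[of _ n] complexify_mult[of A n n A n])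

section \<open>The canonical form of a real matrix with normal square\<close>

theorem theorem2:
  fixes A :: "real mat" and n :: nat
  assumes "A \<in> carrier_mat n n"
  shows
    "(normal_mat (complexify (A ^\<^sub>m 2)) \<longrightarrow>
        (\<exists>Bs. real_canonical_form A Bs) \<and>
        (\<forall>Bs Bs'. real_canonical_form A Bs \<longrightarrow> real_canonical_form A Bs' \<longrightarrow>
           mset Bs = mset Bs') \<and>
        (\<forall>Bs Cs. real_canonical_form A Bs \<longrightarrow> complex_canonical_form (complexify A) Cs \<longrightarrow>
           replace_all_pairs (mset Cs) (mset (map complexify Bs)))) \<and>
     ((\<exists>Bs. set Bs \<subseteq> real_blocks \<and>
            unitarily_similar (complexify A) (complexify (diag_block_mat Bs))) \<longrightarrow>
        normal_mat (complexify (A ^\<^sub>m 2)))"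
proof (intro conjI impI allI)
  assume "normal_mat (complexify (A ^\<^sub>m 2))"
  then show "\<exists>Bs. real_canonical_form A Bs"
    using real_canonical_form_exists[OF assms] complexify_square[OF assms] by simp
next
  fix Bs Bs' assume "real_canonical_form A Bs" "real_canonical_form A Bs'"
  then show "mset Bs = mset Bs'" by (rule real_canonical_form_unique[OF assms])
next
  fix Bs Cs assume Bs: "real_canonical_form A Bs" and Cs: "complex_canonical_form (complexify A) Cs"
  have "set Bs \<subseteq> real_blocks" using Bs unfolding real_canonical_form_def by blast
  then show "replace_all_pairs (mset Cs) (mset (map complexify Bs))"
    unfolding replace_all_pairs_def complex_canonical_form_of_real[OF assms Bs Cs]
    using replace_pairs_concat_split no_replaceable_pair_in_complexified by blast
next
  assume "\<exists>Bs. set Bs \<subseteq> real_blocks \<and> unitarily_similar (complexify A) (complexify (diag_block_mat Bs))"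
  then obtain Bs where Bs: "set Bs \<subseteq> real_blocks"
    and sim: "unitarily_similar (complexify A) (complexify (diag_block_mat Bs))" by blast
  have "normal_mat (complexify (diag_block_mat Bs) ^\<^sub>m 2)"
    unfolding complexify_diag_block_mat
    using Bs normal_square_real_block real_blocks_square by (intro normal_square_diag_block_mat) auto
  then show "normal_mat (complexify (A ^\<^sub>m 2))"
    using normal_square_unitarily_similar[OF sim, of n] assms unfolding complexify_square[OF assms] by simp
qed

end
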